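(* For every rational $\rho\in[0,1/2]$ there exists a finite triangle-free $\rho$-regular graph $G$ such that $a(G)$ attains the maximum value $a(\rho)$ among all such graphs; that is, the supremum of $a(H)$ over all finite triangle-free $\rho$-regular graphs $H$ is attained by some such graph $G$.
   Context: All graphs are finite and simple. For a graph $G$ with $n$ vertices, its edge density is $\rho(G)=\frac{2|E(G)|}{n^2}$ (normalized by $n^2/2$). $G$ is $\rho$-regular if it is regular and $\rho(G)=\rho$, i.e. every vertex has exactly $\rho n$ neighbours. Let $N_G(v)$ be the neighbourhood of $v$ and $$a(G)=\min_{(u,v)\notin E(G)}\frac{|N_G(u)\cap N_G(v)|}{n},$$ the minimum being over all pairs of vertices not forming an edge (pairs with $u=v$ may be included; they contribute the value $\rho$). For rational $\rho\in[0,1/2]$, $a(\rho)$ denotes the largest value (supremum) of $a(G)$ over all triangle-free $\rho$-regular graphs $G$. *)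

theory Defs
  imports Complex_Main "Graph_Theory.Pair_Digraph"
begin

text \<open>
  A finite simple graph is a \<^locale>\<open>pair_graph\<close>: finite vertex set, arcs forming a symmetric and
  irreflexive relation on it.  Each edge is therefore represented by two arcs.
\<close>

definition edges :: "'a pair_pre_digraph \<Rightarrow> 'a set set" where
  "edges G = (\<lambda>(u, v). {u, v}) ` parcs G"

definition edge_density :: "'a pair_pre_digraph \<Rightarrow> real" where
  "edge_density G = 2 * real (card (edges G)) / (real (card (pverts G)))\<^sup>2"

definition nbhd :: "'a pair_pre_digraph \<Rightarrow> 'a \<Rightarrow> 'a set" where
  "nbhd G v = {w. (v, w) \<in> parcs G}"

definition triangle_free :: "'a pair_pre_digraph \<Rightarrow> bool" where
  "triangle_free G \<longleftrightarrow> \<not> (\<exists>u v w. (u, v) \<in> parcs G \<and> (v, w) \<in> parcs G \<and> (w, u) \<in> parcs G)"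

definition regular_graph :: "'a pair_pre_digraph \<Rightarrow> bool" where
  "regular_graph G \<longleftrightarrow> (\<exists>d. \<forall>v\<in>pverts G. card (nbhd G v) = d)"

definition rho_regular :: "real \<Rightarrow> 'a pair_pre_digraph \<Rightarrow> bool" where
  "rho_regular \<rho> G \<longleftrightarrow> regular_graph G \<and> edge_density G = \<rho>"

text \<open>
  The minimum ranges over all pairs of vertices that do not form an edge, the diagonal pairs
  \<open>u = v\<close> included, so that it is over a nonempty set whenever \<open>G\<close> has a vertex.
\<close>

definition codeg_density :: "'a pair_pre_digraph \<Rightarrow> real" where
  "codeg_density G = Min {real (card (nbhd G u \<inter> nbhd G v)) / real (card (pverts G)) | u v.
     u \<in> pverts G \<and> v \<in> pverts G \<and> (u, v) \<notin> parcs G}"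

text \<open>The graph without vertices is excluded, as neither density makes sense for it.\<close>

definition admissible :: "real \<Rightarrow> 'a pair_pre_digraph \<Rightarrow> bool" where
  "admissible \<rho> G \<longleftrightarrow>
     pair_graph G \<and> pverts G \<noteq> {} \<and> triangle_free G \<and> rho_regular \<rho> G"

text \<open>
  Every finite graph is isomorphic to one whose vertices are natural numbers, so the supremum over
  graphs on natural numbers is the supremum over all finite graphs; see \<open>admissible_nat_copy\<close>.
\<close>

definition max_codeg_density :: "real \<Rightarrow> real" where
  "max_codeg_density \<rho> = Sup {codeg_density H | H :: nat pair_pre_digraph. admissible \<rho> H}"

lemma nbhd_subset:
  assumes "pair_graph G"
  shows "nbhd G v \<subseteq> pverts G"
proof -
  interpret pair_graph G by fact
  show ?thesis by (auto simp: nbhd_def dest: in_arcsD2)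
qed

lemma codeg_set_finite:
  assumes "finite (pverts G)"
  shows "finite {real (card (nbhd G u \<inter> nbhd G v)) / real (card (pverts G)) | u v.
     u \<in> pverts G \<and> v \<in> pverts G \<and> (u, v) \<notin> parcs G}"
proof (rule finite_subset)
  show "finite ((\<lambda>(u, v). real (card (nbhd G u \<inter> nbhd G v)) / real (card (pverts G)))
      ` (pverts G \<times> pverts G))"
    using assms by simp
qed auto

lemma codeg_density_le_1:
  assumes "pair_graph G" and "pverts G \<noteq> {}"
  shows "codeg_density G \<le> 1"
proof -
  interpret pair_graph G by fact
  from assms(2) obtain v where v: "v \<in> pverts G" by blast
  have le: "card (nbhd G v \<inter> nbhd G v) \<le> card (pverts G)"
    using nbhd_subset[OF assms(1)] pair_finite_verts by (simp add: card_mono)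
  have "codeg_density G \<le> real (card (nbhd G v \<inter> nbhd G v)) / real (card (pverts G))"
    unfolding codeg_density_def
  proof (rule Min_le[OF codeg_set_finite[OF pair_finite_verts]])
    have "(v, v) \<notin> parcs G" using no_loops' by blast
    with v show "real (card (nbhd G v \<inter> nbhd G v)) / real (card (pverts G))
      \<in> {real (card (nbhd G u \<inter> nbhd G v)) / real (card (pverts G)) | u v.
        u \<in> pverts G \<and> v \<in> pverts G \<and> (u, v) \<notin> parcs G}" by blast
  qed
  also have "\<dots> \<le> 1"
    using le assms(2) pair_finite_verts by (simp add: divide_le_eq_1 card_gt_0_iff)
  finally show ?thesis .
qed

lemma codeg_densities_bdd_above:
  "bdd_above {codeg_density H | H :: nat pair_pre_digraph. admissible \<rho> H}"
proof (rule bdd_aboveI[of _ 1])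
  fix x assume "x \<in> {codeg_density H | H :: nat pair_pre_digraph. admissible \<rho> H}"
  then obtain H :: "nat pair_pre_digraph" where "x = codeg_density H" "admissible \<rho> H" by blast
  then show "x \<le> 1" using codeg_density_le_1[of H] by (simp add: admissible_def)
qed

lemma card_parcs_eq:
  assumes "pair_graph G"
  shows "card (parcs G) = 2 * card (edges G)"
proof -
  interpret pair_graph G by fact
  have un: "parcs G = (\<Union>e\<in>edges G. {a \<in> parcs G. (\<lambda>(u, v). {u, v}) a = e})"
    by (auto simp: edges_def)
  have two: "card {a \<in> parcs G. (\<lambda>(u, v). {u, v}) a = e} = 2" if e: "e \<in> edges G" for e
  proof -
    from e obtain u v where uv: "(u, v) \<in> parcs G" "e = {u, v}"
      by (auto simp: edges_def)
    have "(v, u) \<in> parcs G" using uv(1) by (rule arcs_symmetric)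
    have "{a \<in> parcs G. (\<lambda>(u, v). {u, v}) a = e} = {(u, v), (v, u)}"
    proof
      show "{a \<in> parcs G. (\<lambda>(u, v). {u, v}) a = e} \<subseteq> {(u, v), (v, u)}"
        unfolding uv(2) by (rule subsetI, clarify) (auto simp only: doubleton_eq_iff split: prod.splits)
      show "{(u, v), (v, u)} \<subseteq> {a \<in> parcs G. (\<lambda>(u, v). {u, v}) a = e}"
        using \<open>(u, v) \<in> parcs G\<close> \<open>(v, u) \<in> parcs G\<close> by (simp add: uv(2) insert_commute)
    qed
    moreover have "u \<noteq> v" using no_loops'[OF uv(1)] .
    ultimately show ?thesis by simp
  qed
  have "card (parcs G) = (\<Sum>e\<in>edges G. card {a \<in> parcs G. (\<lambda>(u, v). {u, v}) a = e})"
  proof (subst un, rule card_UN_disjoint)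
    show "finite (edges G)" using pair_finite_arcs by (simp add: edges_def)
    show "\<forall>e\<in>edges G. finite {a \<in> parcs G. (\<lambda>(u, v). {u, v}) a = e}"
      using pair_finite_arcs by simp
  qed blast
  with two show ?thesis by simp
qed

lemma rho_regular_iff:
  assumes "pair_graph G" and "pverts G \<noteq> {}"
  shows "rho_regular \<rho> G \<longleftrightarrow>
    (\<forall>v\<in>pverts G. real (card (nbhd G v)) = \<rho> * real (card (pverts G)))"
proof -
  interpret pair_graph G by fact
  let ?n = "real (card (pverts G))"
  have n: "?n > 0" using assms(2) pair_finite_verts by (simp add: card_gt_0_iff)
  have "parcs G = Sigma (pverts G) (nbhd G)"
    using in_arcsD1 by (auto simp: nbhd_def)
  moreover have "card (Sigma (pverts G) (nbhd G)) = (\<Sum>v\<in>pverts G. card (nbhd G v))"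
    using pair_finite_verts finite_subset[OF nbhd_subset[OF assms(1)]]
    by (intro card_SigmaI) auto
  ultimately have sum: "2 * real (card (edges G)) = (\<Sum>v\<in>pverts G. real (card (nbhd G v)))"
    using card_parcs_eq[OF assms(1)] by (metis of_nat_mult of_nat_numeral of_nat_sum)
  show ?thesis
  proof
    assume L: "rho_regular \<rho> G"
    then obtain d where d: "\<And>v. v \<in> pverts G \<Longrightarrow> card (nbhd G v) = d"
      by (auto simp: rho_regular_def regular_graph_def)
    with sum have "2 * real (card (edges G)) = ?n * d" by simp
    with L n have "\<rho> * ?n = d"
      by (auto simp: rho_regular_def edge_density_def power2_eq_square)
    with d show "\<forall>v\<in>pverts G. real (card (nbhd G v)) = \<rho> * ?n" by simp
  next
    assume R: "\<forall>v\<in>pverts G. real (card (nbhd G v)) = \<rho> * ?n"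
    with sum have "2 * real (card (edges G)) = ?n * (\<rho> * ?n)" by simp
    with n assms(2) have "edge_density G = \<rho>"
      by (simp add: edge_density_def power2_eq_square)
    moreover from assms(2) obtain v where "v \<in> pverts G" by blast
    with R have "\<forall>w\<in>pverts G. card (nbhd G w) = card (nbhd G v)"
      by (metis of_nat_eq_iff)
    ultimately show "rho_regular \<rho> G" by (auto simp: rho_regular_def regular_graph_def)
  qed
qed

lemma admissible_nat_copy:
  fixes G :: "'a pair_pre_digraph"
  assumes adm: "admissible \<rho> G"
  shows "\<exists>H :: nat pair_pre_digraph. admissible \<rho> H \<and> codeg_density H = codeg_density G"
proof -
  have pg: "pair_graph G" and ne: "pverts G \<noteq> {}" and tf: "triangle_free G"
    and rr: "rho_regular \<rho> G" using adm by (auto simp: admissible_def)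
  interpret pair_graph G by fact
  obtain f :: "'a \<Rightarrow> nat" where f: "inj_on f (pverts G)"
    using finite_imp_inj_to_nat_seg[OF pair_finite_verts] by blast
  define H where "H = \<lparr> pverts = f ` pverts G, parcs = map_prod f f ` parcs G \<rparr>"
  have arc: "(f u, f v) \<in> parcs H \<longleftrightarrow> (u, v) \<in> parcs G"
    if "u \<in> pverts G" "v \<in> pverts G" for u v
  proof
    assume "(f u, f v) \<in> parcs H"
    then obtain u' v' where e: "(u', v') \<in> parcs G" and "f u = f u'" "f v = f v'"
      by (auto simp: H_def)
    moreover have "u' \<in> pverts G" "v' \<in> pverts G"
      using in_arcsD1[OF e] in_arcsD2[OF e] by auto
    ultimately have "u = u'" "v = v'" using that f by (auto dest: inj_onD)
    with e show "(u, v) \<in> parcs G" by simp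
  qed (auto simp: H_def)
  have arcE: "\<exists>u v. x = f u \<and> y = f v \<and> u \<in> pverts G \<and> v \<in> pverts G \<and> (u, v) \<in> parcs G"
    if "(x, y) \<in> parcs H" for x y
  proof -
    from that obtain u v where e: "(u, v) \<in> parcs G" "x = f u" "y = f v" by (auto simp: H_def)
    with in_arcsD1[OF e(1)] in_arcsD2[OF e(1)] show ?thesis by blast
  qed
  have pv: "pverts H = f ` pverts G" by (simp add: H_def)
  have cardV: "card (pverts H) = card (pverts G)"
    using f by (simp add: pv card_image)
  have pgH: "pair_graph H"
  proof unfold_locales
    fix e assume e: "e \<in> parcs H"
    then obtain u v where uv: "e = (f u, f v)" "u \<in> pverts G" "v \<in> pverts G" "(u, v) \<in> parcs G"
      using arcE[of "fst e" "snd e"] by (metis prod.collapse)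
    then show "fst e \<in> pverts H" "snd e \<in> pverts H" by (auto simp: pv)
    have "u \<noteq> v" using no_loops'[OF uv(4)] .
    then show "fst e \<noteq> snd e" using uv f by (auto dest: inj_onD)
  next
    show "symmetric (with_proj H)" unfolding symmetric_def
    proof (rule symI)
      fix x y assume "(x, y) \<in> arcs_ends (with_proj H)"
      then have "(x, y) \<in> parcs H" by simp
      then obtain u v where uv: "x = f u" "y = f v" "u \<in> pverts G" "v \<in> pverts G"
        and e: "(u, v) \<in> parcs G" using arcE by blast
      from e have "(v, u) \<in> parcs G" by (rule arcs_symmetric)
      then show "(y, x) \<in> arcs_ends (with_proj H)" using uv arc by simp
    qed
  qed (use pair_finite_verts pair_finite_arcs in \<open>auto simp: H_def\<close>)
  have nb: "nbhd H (f v) = f ` nbhd G v" if v: "v \<in> pverts G" for v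
  proof
    show "nbhd H (f v) \<subseteq> f ` nbhd G v"
    proof
      fix y assume "y \<in> nbhd H (f v)"
      then have y: "(f v, y) \<in> parcs H" by (simp add: nbhd_def)
      then obtain w where "y = f w" "w \<in> pverts G" using arcE by blast
      with y arc[OF v] show "y \<in> f ` nbhd G v" by (simp add: nbhd_def)
    qed
    show "f ` nbhd G v \<subseteq> nbhd H (f v)" by (auto simp: nbhd_def H_def)
  qed
  have "triangle_free H"
    unfolding triangle_free_def
  proof safe
    fix x y z assume a: "(x, y) \<in> parcs H" "(y, z) \<in> parcs H" "(z, x) \<in> parcs H"
    obtain u v w where "x = f u" "y = f v" "z = f w" "u \<in> pverts G" "v \<in> pverts G" "w \<in> pverts G"
      using arcE[OF a(1)] arcE[OF a(2)] by blast
    with a arc have "(u, v) \<in> parcs G" "(v, w) \<in> parcs G" "(w, u) \<in> parcs G" by simp_all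
    with tf show False unfolding triangle_free_def by blast
  qed
  moreover have "rho_regular \<rho> H"
  proof -
    have "card (nbhd H (f v)) = card (nbhd G v)" if "v \<in> pverts G" for v
      using card_image[OF inj_on_subset[OF f nbhd_subset[OF pg]]] nb[OF that] by simp
    moreover have "pverts H \<noteq> {}" using ne by (simp add: pv)
    ultimately show ?thesis
      using rr by (simp add: rho_regular_iff[OF pg ne] rho_regular_iff[OF pgH] cardV)
        (simp add: pv)
  qed
  moreover have "codeg_density H = codeg_density G"
  proof -
    have c: "card (nbhd H (f u) \<inter> nbhd H (f v)) = card (nbhd G u \<inter> nbhd G v)"
      if "u \<in> pverts G" "v \<in> pverts G" for u v
    proof -
      have "nbhd H (f u) \<inter> nbhd H (f v) = f ` (nbhd G u \<inter> nbhd G v)"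
        unfolding nb[OF that(1)] nb[OF that(2)]
        by (rule inj_on_image_Int[symmetric, OF f nbhd_subset[OF pg] nbhd_subset[OF pg]])
      moreover have "inj_on f (nbhd G u \<inter> nbhd G v)"
        by (rule inj_on_subset[OF f le_infI1[OF nbhd_subset[OF pg]]])
      ultimately show ?thesis by (simp add: card_image)
    qed
    have "{real (card (nbhd H x \<inter> nbhd H y)) / real (card (pverts H)) | x y.
        x \<in> pverts H \<and> y \<in> pverts H \<and> (x, y) \<notin> parcs H}
      = {real (card (nbhd G u \<inter> nbhd G v)) / real (card (pverts G)) | u v.
        u \<in> pverts G \<and> v \<in> pverts G \<and> (u, v) \<notin> parcs G}" (is "?A = ?B")
    proof
      show "?A \<subseteq> ?B"
      proof
        fix r assume "r \<in> ?A"
        then obtain x y where "x \<in> pverts H" "y \<in> pverts H" and xy: "(x, y) \<notin> parcs H"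
          and r: "r = real (card (nbhd H x \<inter> nbhd H y)) / real (card (pverts H))" by blast
        then obtain u v where uv: "x = f u" "y = f v" "u \<in> pverts G" "v \<in> pverts G"
          by (auto simp: pv)
        then have "(u, v) \<notin> parcs G" using xy arc by blast
        then show "r \<in> ?B"
          using r uv(3,4) unfolding uv(1,2) c[OF uv(3,4)] cardV by blast
      qed
      show "?B \<subseteq> ?A"
      proof
        fix r assume "r \<in> ?B"
        then obtain u v where uv: "u \<in> pverts G" "v \<in> pverts G" and n: "(u, v) \<notin> parcs G"
          and r: "r = real (card (nbhd G u \<inter> nbhd G v)) / real (card (pverts G))" by blast
        have "f u \<in> pverts H" "f v \<in> pverts H" "(f u, f v) \<notin> parcs H"
          using uv n arc by (auto simp: pv)
        moreover have "r = real (card (nbhd H (f u) \<inter> nbhd H (f v))) / real (card (pverts H))"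
          using r c[OF uv] cardV by simp
        ultimately show "r \<in> ?A" by blast
      qed
    qed
    then show ?thesis by (simp add: codeg_density_def)
  qed
  moreover have "pverts H \<noteq> {}" using ne by (simp add: pv)
  ultimately show ?thesis
    using pgH unfolding admissible_def by blast
qed

end

theory Submission
  imports Defs "HOL-Real_Asymp.Real_Asymp" "HOL-Number_Theory.Cong"
begin

text \<open>
  The supremum is attained because only finitely many shapes of graphs compete for it, and for each
  shape the best value is the optimum of a linear program with rational data.

  Fix a triangle-free graph in which any two non-adjacent vertices have at least \<open>a * n\<close> common
  neighbours, where \<open>a > 0\<close> and \<open>n\<close> is the number of vertices. If \<open>w\<close> is adjacent to \<open>u\<close> but not to
  \<open>v\<close>, then the common neighbours of \<open>w\<close> and \<open>v\<close> are neighbours of \<open>v\<close> that are not neighbours of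
  \<open>u\<close>, since there is no triangle; hence two distinct neighbourhoods differ in at least \<open>a * n\<close>
  vertices (\<open>nbhds_separated\<close>). A double count shows that a set shattered by the neighbourhoods has
  at most \<open>1 / a\<close> elements (\<open>shattered_small\<close>). A separated family of bounded
  Vapnik-Chervonenkis dimension has bounded size (\<open>separated_family_bound\<close>), so the number of
  distinct neighbourhoods is bounded in terms of \<open>a\<close> alone (\<open>nbhd_classes_bound\<close>).

  Identifying vertices with equal neighbourhoods turns a graph into a weighted triangle-free pattern
  on boundedly many vertices (\<open>twin_reduction\<close>), and conversely every rational weighting of a pattern
  comes from a graph, a blow-up (\<open>blow_up\<close>). For a fixed pattern the regularity and codegree
  conditions are linear in the weights and in the codegree bound \<open>t\<close>; Fourier-Motzkin elimination of
  the weights over the rationals leaves finitely many weak inequalities for \<open>t\<close>, so a largest \<open>t\<close>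
  exists and is reached at rational weights (\<open>param_polyhedral_attains_max\<close>). The best of the finitely
  many patterns gives the maximum whenever some graph has positive codegree density
  (\<open>best_above_positive\<close>); otherwise all codegree densities are zero, and any admissible graph, for
  instance a bipartite circulant (\<open>admissible_exists\<close>), attains the supremum.
\<close>
section \<open>Shattering and hitting sets\<close>

definition shatters :: "'a set set \<Rightarrow> 'a set \<Rightarrow> bool" where
  "shatters F X \<longleftrightarrow> (\<forall>I\<subseteq>X. \<exists>A\<in>F. A \<inter> X = I)"

text \<open>
  Pajor's form of the Sauer-Shelah lemma. Removing a point \<open>s\<close> from all members merges those pairs of
  members that differ only in \<open>s\<close>; what is lost in this way is recovered by the sets \<open>insert s X\<close>
  with \<open>X\<close> shattered by the merged members.
\<close>
lemma card_le_card_shattered: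
  assumes "finite S" and "F \<subseteq> Pow S"
  shows "card F \<le> card {X. X \<subseteq> S \<and> shatters F X}"
  using assms
proof (induction S arbitrary: F rule: finite_induct)
  case empty
  show ?case
  proof (cases "F = {}")
    case False
    with empty have "F = {{}}" by auto
    then have "{X. X \<subseteq> {} \<and> shatters F X} = {{}}" by (auto simp: shatters_def)
    with \<open>F = {{}}\<close> show ?thesis by simp
  qed simp
next
  case (insert s S)
  define B where "B = {A \<in> F. s \<notin> A}"
  define C where "C = (\<lambda>A. A - {s}) ` {A \<in> F. s \<in> A}"
  have finF: "finite F" using insert.prems insert.hyps(1) by (simp add: finite_subset)
  have "inj_on (\<lambda>A. A - {s}) {A \<in> F. s \<in> A}"
    by (rule inj_onI) auto
  then have cardC: "card C = card {A \<in> F. s \<in> A}" by (simp add: C_def card_image)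
  have "F = B \<union> {A \<in> F. s \<in> A}" by (auto simp: B_def)
  moreover have "card (B \<union> {A \<in> F. s \<in> A}) = card B + card {A \<in> F. s \<in> A}"
    by (rule card_Un_disjoint) (use finF in \<open>auto simp: B_def\<close>)
  ultimately have "card F = card B + card C" using cardC by simp
  also have "\<dots> = card (B \<union> C) + card (B \<inter> C)"
    by (rule card_Un_Int) (use finF in \<open>auto simp: B_def C_def\<close>)
  also have "\<dots> \<le> card {X. X \<subseteq> S \<and> shatters (B \<union> C) X} + card {X. X \<subseteq> S \<and> shatters (B \<inter> C) X}"
    by (intro add_mono insert.IH) (use insert.prems in \<open>auto simp: B_def C_def\<close>)
  also have "card {X. X \<subseteq> S \<and> shatters (B \<inter> C) X}
      = card (insert s ` {X. X \<subseteq> S \<and> shatters (B \<inter> C) X})"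
  proof (rule card_image[symmetric], rule inj_onI)
    fix X Y assume "X \<in> {X. X \<subseteq> S \<and> shatters (B \<inter> C) X}"
      and "Y \<in> {X. X \<subseteq> S \<and> shatters (B \<inter> C) X}" and "insert s X = insert s Y"
    moreover from this have "s \<notin> X" "s \<notin> Y" using insert.hyps(2) by auto
    ultimately show "X = Y" by (simp add: insert_ident)
  qed
  also have "card {X. X \<subseteq> S \<and> shatters (B \<union> C) X} + \<dots>
      = card ({X. X \<subseteq> S \<and> shatters (B \<union> C) X}
          \<union> insert s ` {X. X \<subseteq> S \<and> shatters (B \<inter> C) X})"
    by (rule card_Un_disjoint[symmetric]) (use insert.hyps in auto)
  also have "\<dots> \<le> card {X. X \<subseteq> insert s S \<and> shatters F X}"
  proof (rule card_mono)
    show "finite {X. X \<subseteq> insert s S \<and> shatters F X}" using insert.hyps(1) by simp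
    have "shatters F X" if X: "X \<subseteq> S" and sh: "shatters (B \<union> C) X" for X
      unfolding shatters_def
    proof (intro allI impI)
      fix I assume "I \<subseteq> X"
      with sh obtain A where A: "A \<in> B \<union> C" "A \<inter> X = I" by (auto simp: shatters_def)
      have "s \<notin> X" using X insert.hyps(2) by blast
      with A have "(A \<in> F \<or> insert s A \<in> F) \<and> insert s A \<inter> X = I"
        by (auto simp: B_def C_def insert_absorb)
      with A(2) show "\<exists>A\<in>F. A \<inter> X = I" by blast
    qed
    moreover have "shatters F (insert s X)"
      if X: "X \<subseteq> S" and sh: "shatters (B \<inter> C) X" for X
      unfolding shatters_def
    proof (intro allI impI)
      fix I assume I: "I \<subseteq> insert s X"
      then have "I - {s} \<subseteq> X" by blast
      from sh[unfolded shatters_def, rule_format, OF this]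
      obtain A where A: "A \<in> B \<inter> C" "A \<inter> X = I - {s}" ..
      from A(1) obtain A' where "A' \<in> F" "s \<in> A'" "A = A' - {s}" by (auto simp only: C_def)
      then have "insert s A \<in> F" by (simp add: insert_absorb)
      moreover have "A \<in> F" "s \<notin> A" using A(1) by (simp_all add: B_def)
      moreover have "s \<notin> X" using X insert.hyps(2) by blast
      ultimately have "(if s \<in> I then insert s A else A) \<in> F"
        and "(if s \<in> I then insert s A else A) \<inter> insert s X = I"
        using A(2) I by (simp, auto)
      then show "\<exists>A\<in>F. A \<inter> insert s X = I" by (rule bexI[rotated])
    qed
    ultimately show "{X. X \<subseteq> S \<and> shatters (B \<union> C) X}
        \<union> insert s ` {X. X \<subseteq> S \<and> shatters (B \<inter> C) X}
        \<subseteq> {X. X \<subseteq> insert s S \<and> shatters F X}"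
      by auto
  qed
  finally show ?case .
qed

lemma card_small_subsets_le:
  assumes "finite S" and "card S \<le> m"
  shows "card {X. X \<subseteq> S \<and> card X \<le> d} \<le> Suc d * Suc m ^ d"
proof -
  have "{X. X \<subseteq> S \<and> card X \<le> d} \<subseteq> set ` {xs. set xs \<subseteq> S \<and> length xs \<le> d}"
  proof
    fix X assume X: "X \<in> {X. X \<subseteq> S \<and> card X \<le> d}"
    then have "finite X" using assms(1) by (auto intro: finite_subset)
    then obtain xs where xs: "set xs = X" "distinct xs" using finite_distinct_list by blast
    then have "length xs = card X" by (metis distinct_card)
    with X xs(1) show "X \<in> set ` {xs. set xs \<subseteq> S \<and> length xs \<le> d}"
      by (intro image_eqI[of _ _ xs]) auto
  qed
  then have "card {X. X \<subseteq> S \<and> card X \<le> d} \<le> card {xs. set xs \<subseteq> S \<and> length xs \<le> d}"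
    using surj_card_le finite_lists_length_le[OF assms(1)] by blast
  also have "\<dots> = (\<Sum>i\<le>d. card S ^ i)" by (rule card_lists_length_le[OF assms(1)])
  also have "\<dots> \<le> (\<Sum>i\<le>d. Suc m ^ d)"
  proof (rule sum_mono)
    fix i assume "i \<in> {..d}"
    have "card S ^ i \<le> Suc m ^ i" using assms(2) by (intro power_mono) auto
    also have "\<dots> \<le> Suc m ^ d" using \<open>i \<in> {..d}\<close> by (intro power_increasing) auto
    finally show "card S ^ i \<le> Suc m ^ d" .
  qed
  finally show ?thesis by simp
qed

text \<open>
  Greedy choice: by averaging, some point lies in at least the fraction \<open>a\<close> of the sets not yet hit,
  so each further point reduces the unhit sets by the factor \<open>1 - a\<close>.
\<close>
lemma exists_almost_hitting_set:
  fixes a :: real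
  assumes fin: "finite V" "finite \<D>" and "V \<noteq> {}" and "a \<le> 1"
    and large: "\<And>D. D \<in> \<D> \<Longrightarrow> D \<subseteq> V \<and> a * real (card V) \<le> real (card D)"
  shows "\<exists>S\<subseteq>V. card S \<le> m \<and> real (card {D \<in> \<D>. D \<inter> S = {}}) \<le> (1 - a) ^ m * real (card \<D>)"
proof (induction m)
  case 0
  show ?case by (rule exI[of _ "{}"]) simp
next
  case (Suc m)
  then obtain S where S: "S \<subseteq> V" "card S \<le> m"
    and le: "real (card {D \<in> \<D>. D \<inter> S = {}}) \<le> (1 - a) ^ m * real (card \<D>)" by blast
  define \<R> where "\<R> = {D \<in> \<D>. D \<inter> S = {}}"
  have finR: "finite \<R>" using fin by (simp add: \<R>_def)
  have dbl: "(\<Sum>v\<in>V. card {D \<in> \<R>. v \<in> D}) = (\<Sum>D\<in>\<R>. card D)"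
  proof -
    have "(\<Sum>v\<in>V. card {D \<in> \<R>. v \<in> D}) = (\<Sum>v\<in>V. \<Sum>D\<in>\<R>. if v \<in> D then 1 else 0)"
      using finR by (intro sum.cong refl) (simp add: sum.If_cases Int_def)
    also have "\<dots> = (\<Sum>D\<in>\<R>. \<Sum>v\<in>V. if v \<in> D then 1 else 0)" by (rule sum.swap)
    also have "\<dots> = (\<Sum>D\<in>\<R>. card D)"
    proof (rule sum.cong)
      fix D assume "D \<in> \<R>"
      then have "{v \<in> V. v \<in> D} = D" using large by (auto simp: \<R>_def)
      then show "(\<Sum>v\<in>V. if v \<in> D then 1 else 0) = card D"
        using fin(1) by (simp add: sum.If_cases Int_def)
    qed simp
    finally show ?thesis .
  qed
  have "\<exists>v\<in>V. a * real (card \<R>) \<le> real (card {D \<in> \<R>. v \<in> D})"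
  proof (rule ccontr)
    assume "\<not> ?thesis"
    then have "(\<Sum>v\<in>V. real (card {D \<in> \<R>. v \<in> D})) < (\<Sum>v\<in>V. a * real (card \<R>))"
      using fin(1) \<open>V \<noteq> {}\<close> by (intro sum_strict_mono) (auto simp: not_le)
    moreover have "(\<Sum>D\<in>\<R>. a * real (card V)) \<le> (\<Sum>D\<in>\<R>. real (card D))"
      using large by (intro sum_mono) (auto simp: \<R>_def)
    ultimately show False using dbl[THEN arg_cong[of _ _ real]] by (simp add: mult_ac)
  qed
  then obtain v where v: "v \<in> V" "a * real (card \<R>) \<le> real (card {D \<in> \<R>. v \<in> D})" by blast
  have split: "{D \<in> \<D>. D \<inter> insert v S = {}} = \<R> - {D \<in> \<R>. v \<in> D}" by (auto simp: \<R>_def)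
  have "card {D \<in> \<R>. v \<in> D} \<le> card \<R>" using finR by (simp add: card_mono)
  then have "real (card {D \<in> \<D>. D \<inter> insert v S = {}})
      = real (card \<R>) - real (card {D \<in> \<R>. v \<in> D})"
    unfolding split using finR by (subst card_Diff_subset) (auto simp: of_nat_diff)
  also have "\<dots> \<le> (1 - a) * real (card \<R>)" using v(2) by (simp add: algebra_simps)
  also have "\<dots> \<le> (1 - a) * ((1 - a) ^ m * real (card \<D>))"
    using le \<open>a \<le> 1\<close> by (intro mult_left_mono) (simp_all add: \<R>_def)
  finally have "real (card {D \<in> \<D>. D \<inter> insert v S = {}}) \<le> (1 - a) ^ Suc m * real (card \<D>)"
    by simp
  moreover have "card (insert v S) \<le> Suc m"
    using S finite_subset[OF S(1) fin(1)] by (simp add: card_insert_if)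
  ultimately show ?case using v(1) S(1) by (intro exI[of _ "insert v S"]) auto
qed

text \<open>
  The bound is a qualitative version of Haussler's packing theorem. A subfamily of exactly \<open>p m\<close>
  members has fewer than \<open>(p m)\<^sup>2\<close> differences, all large, so that some \<open>m\<close> points meet each of them as
  soon as \<open>m\<close> is so large that the exponential \<open>(1 - a) ^ m\<close> outweighs the polynomial \<open>(p m)\<^sup>2\<close>. The traces of
  the members on these points are then distinct, but by the Sauer-Shelah lemma there are fewer than
  \<open>p m\<close> traces.
\<close>
lemma separated_family_bound:
  fixes a :: real
  assumes "0 < a" and "a \<le> 1"
  shows "\<exists>K. \<forall>(V :: 'a set) F. finite V \<longrightarrow> V \<noteq> {} \<longrightarrow> F \<subseteq> Pow V \<longrightarrow>
    (\<forall>A\<in>F. \<forall>B\<in>F. A \<noteq> B \<longrightarrow> a * real (card V) \<le> real (card ((A - B) \<union> (B - A)))) \<longrightarrow>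
    (\<forall>X\<subseteq>V. shatters F X \<longrightarrow> card X \<le> d) \<longrightarrow> card F \<le> K"
proof -
  \<comment> \<open>Any \<open>p\<close> of polynomial growth above the Sauer-Shelah bound \<open>Suc d * Suc m ^ d\<close> would do.\<close>
  define p where "p m = 2 * (Suc d * Suc m ^ d)" for m
  have "((\<lambda>m. (1 - a) ^ m * (real (p m))\<^sup>2) \<longlongrightarrow> 0) at_top"
  proof (cases "a = 1")
    case True
    have "eventually (\<lambda>m. (1 - a) ^ m * (real (p m))\<^sup>2 = 0) at_top"
      using eventually_gt_at_top[of 0] by eventually_elim (use True in auto)
    then show ?thesis by (rule tendsto_eventually)
  next
    case False
    with assms have "0 < 1 - a" "1 - a < 1" by auto
    define c where "c = - ln (1 - a)"
    have "c > 0" using \<open>0 < 1 - a\<close> \<open>1 - a < 1\<close> by (simp add: c_def)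
    define C where "C = (2 * real (Suc d))\<^sup>2"
    define k where "k = 2 * real d"
    have "(1 - a) ^ m * (real (p m))\<^sup>2 = C * (exp (- (c * real m)) * (real m + 1) powr k)" for m
    proof -
      have "(1 - a) ^ m = exp (ln (1 - a) * real m)"
        using \<open>0 < 1 - a\<close> by (metis exp_ln exp_of_nat2_mult)
      moreover have "(real m + 1) powr k = (real (Suc m) ^ d)\<^sup>2"
        by (simp add: k_def powr_realpow[symmetric] powr_powr add.commute mult.commute
            flip: power_mult)
      ultimately show ?thesis
        by (simp add: c_def C_def p_def power2_eq_square algebra_simps)
    qed
    moreover have "(\<lambda>m. C * (exp (- (c * real m)) * (real m + 1) powr k)) \<longlonglongrightarrow> 0"
      using \<open>c > 0\<close> by real_asymp
    ultimately show ?thesis by simp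
  qed
  then have "eventually (\<lambda>m. (1 - a) ^ m * (real (p m))\<^sup>2 < 1) at_top"
    by (rule order_tendstoD) simp
  then obtain m where m: "(1 - a) ^ m * (real (p m))\<^sup>2 < 1"
    by (auto simp: eventually_at_top_linorder)
  show ?thesis
  proof (intro exI[of _ "p m"] allI impI)
    fix V :: "'a set" and F
    assume V: "finite V" "V \<noteq> {}" and FV: "F \<subseteq> Pow V"
      and sep: "\<forall>A\<in>F. \<forall>B\<in>F. A \<noteq> B \<longrightarrow> a * real (card V) \<le> real (card ((A - B) \<union> (B - A)))"
      and vc: "\<forall>X\<subseteq>V. shatters F X \<longrightarrow> card X \<le> d"
    show "card F \<le> p m"
    proof (rule ccontr)
      assume "\<not> card F \<le> p m"
      then obtain E where E: "E \<subseteq> F" "card E = p m" "finite E"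
        by (meson nat_le_linear obtain_subset_with_card_n)
      define \<D> where "\<D> = (\<lambda>(A, B). (A - B) \<union> (B - A)) ` {(A, B) \<in> E \<times> E. A \<noteq> B}"
      have fin: "finite \<D>" unfolding \<D>_def by (rule finite_imageI, rule finite_subset[of _ "E \<times> E"])
          (use E(3) in auto)
      have "card \<D> \<le> card {(A, B) \<in> E \<times> E. A \<noteq> B}" unfolding \<D>_def
        by (rule card_image_le, rule finite_subset[of _ "E \<times> E"]) (use E(3) in auto)
      also have "\<dots> \<le> card (E \<times> E)" by (rule card_mono) (use E(3) in auto)
      finally have "card \<D> \<le> (p m)\<^sup>2" using E(2) by (simp add: card_cartesian_product power2_eq_square)
      then have "real (card \<D>) \<le> (real (p m))\<^sup>2" by (metis of_nat_le_iff of_nat_power)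
      then have lt: "(1 - a) ^ m * real (card \<D>) < 1"
        using m assms(2) by (smt (verit) mult_left_mono zero_le_power)
      have "D \<subseteq> V \<and> a * real (card V) \<le> real (card D)" if "D \<in> \<D>" for D
      proof -
        obtain A B where AB: "A \<in> E" "B \<in> E" "A \<noteq> B" and D: "D = (A - B) \<union> (B - A)"
          using \<open>D \<in> \<D>\<close> by (auto simp: \<D>_def)
        have "A \<in> F" "B \<in> F" using AB E(1) by auto
        then have "D \<subseteq> V" using FV D by blast
        with sep[rule_format, OF \<open>A \<in> F\<close> \<open>B \<in> F\<close> \<open>A \<noteq> B\<close>] D show ?thesis by simp
      qed
      from exists_almost_hitting_set[OF V(1) fin V(2) assms(2) this, of m]
      obtain S where S: "S \<subseteq> V" "card S \<le> m" and
        "real (card {D \<in> \<D>. D \<inter> S = {}}) \<le> (1 - a) ^ m * real (card \<D>)" by blast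
      with lt have "card {D \<in> \<D>. D \<inter> S = {}} = 0" by linarith
      with fin have hit: "\<And>D. D \<in> \<D> \<Longrightarrow> D \<inter> S \<noteq> {}" by auto
      have finS: "finite S" using S(1) V(1) finite_subset by blast
      have "inj_on (\<lambda>A. A \<inter> S) E"
      proof (rule inj_onI, rule ccontr)
        fix A B assume *: "A \<in> E" "B \<in> E" "A \<inter> S = B \<inter> S" "A \<noteq> B"
        then have "(A - B) \<union> (B - A) \<in> \<D>" by (auto simp: \<D>_def)
        with hit *(3) show False by blast
      qed
      then have "p m = card ((\<lambda>A. A \<inter> S) ` E)" using E(2) by (simp add: card_image)
      also have "\<dots> \<le> card {X. X \<subseteq> S \<and> shatters ((\<lambda>A. A \<inter> S) ` E) X}"
        by (rule card_le_card_shattered[OF finS]) auto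
      also have "\<dots> \<le> card {X. X \<subseteq> S \<and> card X \<le> d}"
      proof (rule card_mono)
        show "{X. X \<subseteq> S \<and> shatters ((\<lambda>A. A \<inter> S) ` E) X} \<subseteq> {X. X \<subseteq> S \<and> card X \<le> d}"
        proof clarify
          fix X assume X: "X \<subseteq> S" "shatters ((\<lambda>A. A \<inter> S) ` E) X"
          have "shatters F X" unfolding shatters_def
          proof (intro allI impI)
            fix I assume "I \<subseteq> X"
            with X(2) obtain A where A: "A \<in> E" "A \<inter> S \<inter> X = I" by (auto simp: shatters_def)
            then have "A \<inter> X = I" using X(1) by blast
            then show "\<exists>A\<in>F. A \<inter> X = I" using A(1) E(1) by blast
          qed
          then show "card X \<le> d" using vc X(1) S(1) by blast
        qed
      qed (use finS in simp)
      also have "\<dots> \<le> Suc d * Suc m ^ d" by (rule card_small_subsets_le[OF finS S(2)])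
      finally show False by (simp add: p_def)
    qed
  qed
qed

section \<open>Triangle-free graphs with large codegrees\<close>

locale dense_codegree_graph = pair_graph G for G :: "'a pair_pre_digraph" +
  fixes a :: real
  assumes tri: "triangle_free G"
    and nonempty: "pverts G \<noteq> {}"
    and codegree: "\<And>u v. u \<in> pverts G \<Longrightarrow> v \<in> pverts G \<Longrightarrow> (u, v) \<notin> parcs G \<Longrightarrow>
      a * real (card (pverts G)) \<le> real (card (nbhd G u \<inter> nbhd G v))"
begin

lemma nbhd_sub: "nbhd G v \<subseteq> pverts G"
  by (rule nbhd_subset) unfold_locales

lemma finite_nbhd: "finite (nbhd G v)"
  using nbhd_sub pair_finite_verts finite_subset by blast

lemma no_triangle: "w \<in> nbhd G u \<Longrightarrow> x \<in> nbhd G u \<Longrightarrow> x \<notin> nbhd G w"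
  using tri arcs_symmetric unfolding triangle_free_def nbhd_def by blast

lemma nbhd_sym: "v \<in> nbhd G u \<longleftrightarrow> u \<in> nbhd G v"
  using arcs_symmetric unfolding nbhd_def by blast

text \<open>
  The vertex \<open>w\<close> is not adjacent to \<open>v\<close>, so these two have many common neighbours, none of which is a
  neighbour of \<open>u\<close>, as it would form a triangle with \<open>u\<close> and \<open>w\<close>. One separating vertex thus forces
  many.
\<close>
lemma nbhd_diff_large:
  assumes "v \<in> pverts G" and "w \<in> nbhd G u" and "w \<notin> nbhd G v"
  shows "a * real (card (pverts G)) \<le> real (card (nbhd G v - nbhd G u))"
proof -
  have "(w, v) \<notin> parcs G" using assms(3) nbhd_sym by (auto simp: nbhd_def)
  then have "a * real (card (pverts G)) \<le> real (card (nbhd G w \<inter> nbhd G v))"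
    using assms nbhd_sub by (intro codegree) auto
  also have "nbhd G w \<inter> nbhd G v \<subseteq> nbhd G v - nbhd G u"
    using no_triangle assms(2) by blast
  then have "card (nbhd G w \<inter> nbhd G v) \<le> card (nbhd G v - nbhd G u)"
    by (intro card_mono) (simp_all add: finite_nbhd)
  finally show ?thesis by simp
qed

lemma nbhds_separated:
  assumes "A \<in> nbhd G ` pverts G" and "B \<in> nbhd G ` pverts G" and "A \<noteq> B"
  shows "a * real (card (pverts G)) \<le> real (card ((A - B) \<union> (B - A)))"
proof -
  obtain u v where uv: "u \<in> pverts G" "v \<in> pverts G" "A = nbhd G u" "B = nbhd G v"
    using assms by blast
  have le: "card (A - B) \<le> card ((A - B) \<union> (B - A))" "card (B - A) \<le> card ((A - B) \<union> (B - A))"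
    using uv by (auto intro!: card_mono simp: finite_nbhd)
  from assms(3) consider w where "w \<in> A" "w \<notin> B" | w where "w \<in> B" "w \<notin> A" by blast
  then show ?thesis
  proof cases
    case 1
    with nbhd_diff_large[of v _ u] uv le show ?thesis by fastforce
  next
    case 2
    with nbhd_diff_large[of u _ v] uv le show ?thesis by fastforce
  qed
qed

text \<open>
  For \<open>I \<subseteq> X\<close> let \<open>y I\<close> be a vertex whose neighbours in \<open>X\<close> are exactly \<open>I\<close>. Count the triples
  \<open>(x, I, z)\<close> with \<open>x \<in> X - I\<close> and \<open>z\<close> a common neighbour of \<open>x\<close> and \<open>y I\<close>. Since \<open>x\<close> and \<open>y I\<close> are not
  adjacent, each of the \<open>card X * 2 ^ (card X - 1)\<close> pairs \<open>(x, I)\<close> occurs for at least \<open>a * n\<close>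
  vertices \<open>z\<close>. On the other hand, if \<open>z\<close> has the neighbours \<open>A\<close> in \<open>X\<close>, then \<open>x \<in> A\<close>, and \<open>I\<close> avoids
  \<open>A\<close> because there is no triangle; so \<open>z\<close> occurs for at most
  \<open>card A * 2 ^ (card X - card A) \<le> 2 ^ (card X - 1)\<close> pairs.
\<close>
lemma shattered_small:
  assumes X: "X \<subseteq> pverts G" and sh: "shatters (nbhd G ` pverts G) X"
  shows "a * real (card X) \<le> 1"
proof -
  have finX: "finite X" using X pair_finite_verts finite_subset by blast
  from sh have "\<forall>I\<in>Pow X. \<exists>y. y \<in> pverts G \<and> nbhd G y \<inter> X = I" by (auto simp: shatters_def)
  then obtain y where y: "\<And>I. I \<subseteq> X \<Longrightarrow> y I \<in> pverts G \<and> nbhd G (y I) \<inter> X = I"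
    by (metis PowI)
  define Z where "Z = Sigma X (\<lambda>x. Pow (X - {x}))"
  have finZ: "finite Z" using finX by (simp add: Z_def)
  have "card Z = (\<Sum>x\<in>X. card (Pow (X - {x})))"
    unfolding Z_def using finX by (intro card_SigmaI) auto
  also have "\<dots> = card X * 2 ^ (card X - 1)" using finX by (simp add: card_Pow)
  finally have "2 * card Z = card X * 2 ^ card X"
    by (cases "card X") auto
  then have cardZ: "2 * real (card Z) = real (card X) * 2 ^ card X"
    by (metis of_nat_mult of_nat_numeral of_nat_power)
  let ?common = "\<lambda>e. nbhd G (fst e) \<inter> nbhd G (y (snd e))"
  have lower: "a * real (card (pverts G)) \<le> real (card (?common e))" if "e \<in> Z" for e
  proof (rule codegree)
    from that have e: "fst e \<in> X" "snd e \<subseteq> X" "fst e \<notin> snd e" by (auto simp: Z_def)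
    show "fst e \<in> pverts G" "y (snd e) \<in> pverts G" using e y X by auto
    have "fst e \<notin> nbhd G (y (snd e))" using e y by blast
    then show "(fst e, y (snd e)) \<notin> parcs G" using nbhd_sym by (auto simp: nbhd_def)
  qed
  have upper: "2 * card {e \<in> Z. z \<in> ?common e} \<le> 2 ^ card X" for z
  proof -
    define A where "A = nbhd G z \<inter> X"
    have A: "A \<subseteq> X" "finite A" using finX by (auto simp: A_def)
    have "{e \<in> Z. z \<in> ?common e} \<subseteq> A \<times> Pow (X - A)"
    proof clarsimp
      fix x I assume e: "(x, I) \<in> Z" "z \<in> nbhd G x" "z \<in> nbhd G (y I)"
      then have xI: "x \<in> X" "I \<subseteq> X" by (auto simp: Z_def)
      have "x \<in> A" using e xI nbhd_sym by (auto simp: A_def)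
      moreover have "i \<in> X - A" if "i \<in> I" for i
      proof -
        have "i \<in> nbhd G (y I)" using that y xI by blast
        then have "i \<notin> nbhd G z" using e(3) no_triangle by blast
        with that xI show ?thesis by (auto simp: A_def)
      qed
      ultimately show "x \<in> A \<and> I \<subseteq> X - A" by blast
    qed
    then have "card {e \<in> Z. z \<in> ?common e} \<le> card (A \<times> Pow (X - A))"
      using A(2) finX by (intro card_mono) auto
    also have "\<dots> = card A * 2 ^ (card X - card A)"
      using A finX by (simp add: card_cartesian_product card_Pow card_Diff_subset)
    finally have "2 * card {e \<in> Z. z \<in> ?common e} \<le> (2 * card A) * 2 ^ (card X - card A)" by simp
    also have "\<dots> \<le> 2 ^ card A * 2 ^ (card X - card A)"
    proof (rule mult_right_mono)
      have "2 * k \<le> 2 ^ k" for k :: nat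
      proof (induction k)
        case (Suc k) then show ?case by (cases k) auto
      qed simp
      then show "2 * card A \<le> 2 ^ card A" .
    qed simp
    also have "\<dots> = 2 ^ card X"
      using card_mono[OF finX A(1)] by (simp flip: power_add)
    finally show ?thesis .
  qed
  have dbl: "(\<Sum>e\<in>Z. card (?common e)) = (\<Sum>z\<in>pverts G. card {e \<in> Z. z \<in> ?common e})"
  proof -
    have "(\<Sum>e\<in>Z. card (?common e)) = (\<Sum>e\<in>Z. \<Sum>z\<in>pverts G. if z \<in> ?common e then 1 else 0)"
    proof (rule sum.cong)
      fix e assume "e \<in> Z"
      have "{z \<in> pverts G. z \<in> ?common e} = ?common e" using nbhd_sub by blast
      then show "card (?common e) = (\<Sum>z\<in>pverts G. if z \<in> ?common e then 1 else 0)"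
        using pair_finite_verts by (simp add: sum.If_cases Int_def)
    qed simp
    also have "\<dots> = (\<Sum>z\<in>pverts G. \<Sum>e\<in>Z. if z \<in> ?common e then 1 else 0)" by (rule sum.swap)
    also have "\<dots> = (\<Sum>z\<in>pverts G. card {e \<in> Z. z \<in> ?common e})"
      using finZ by (intro sum.cong refl) (simp add: sum.If_cases Int_def)
    finally show ?thesis .
  qed
  define n where "n = real (card (pverts G))"
  have n: "n > 0" using nonempty pair_finite_verts by (simp add: n_def card_gt_0_iff)
  have "(a * real (card X)) * (n * 2 ^ card X) = 2 * (\<Sum>e\<in>Z. a * n)"
    using cardZ by (simp add: algebra_simps)
  also have "\<dots> \<le> 2 * (\<Sum>e\<in>Z. real (card (?common e)))"
    using lower by (intro mult_left_mono sum_mono) (auto simp: n_def)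
  also have "\<dots> = (\<Sum>z\<in>pverts G. real (2 * card {e \<in> Z. z \<in> ?common e}))"
    using dbl[THEN arg_cong[of _ _ real]] by (simp add: sum_distrib_left)
  also have "\<dots> \<le> (\<Sum>z\<in>pverts G. 2 ^ card X)"
  proof (rule sum_mono)
    fix z
    show "real (2 * card {e \<in> Z. z \<in> ?common e}) \<le> 2 ^ card X"
      using upper[of z, unfolded of_nat_le_iff[where 'a = real, symmetric]] by simp
  qed
  also have "\<dots> = 1 * (n * 2 ^ card X)" by (simp add: n_def)
  finally show ?thesis using n by (simp add: mult_le_cancel_right)
qed

end

text \<open>
  The bound \<open>K\<close> depends on \<open>a\<close> but not on the number of vertices; this is the source of finiteness.
\<close>
lemma nbhd_classes_bound:
  fixes a :: real
  assumes "0 < a"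
  shows "\<exists>K. \<forall>G :: 'a pair_pre_digraph. dense_codegree_graph G a \<longrightarrow> card (nbhd G ` pverts G) \<le> K"
proof (cases "a \<le> 1")
  case True
  obtain K where K: "\<And>(V :: 'a set) F. finite V \<Longrightarrow> V \<noteq> {} \<Longrightarrow> F \<subseteq> Pow V \<Longrightarrow>
    (\<forall>A\<in>F. \<forall>B\<in>F. A \<noteq> B \<longrightarrow> a * real (card V) \<le> real (card ((A - B) \<union> (B - A)))) \<Longrightarrow>
    (\<forall>X\<subseteq>V. shatters F X \<longrightarrow> card X \<le> nat \<lfloor>1 / a\<rfloor>) \<Longrightarrow> card F \<le> K"
    using separated_family_bound[OF assms True, of "nat \<lfloor>1 / a\<rfloor>"] by metis
  show ?thesis
  proof (intro exI[of _ K] allI impI)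
    fix G :: "'a pair_pre_digraph" assume "dense_codegree_graph G a"
    then interpret dense_codegree_graph G a .
    show "card (nbhd G ` pverts G) \<le> K"
    proof (rule K[of "pverts G"])
      show "\<forall>X\<subseteq>pverts G. shatters (nbhd G ` pverts G) X \<longrightarrow> card X \<le> nat \<lfloor>1 / a\<rfloor>"
      proof (intro allI impI)
        fix X assume "X \<subseteq> pverts G" "shatters (nbhd G ` pverts G) X"
        then have "a * real (card X) \<le> 1" by (rule shattered_small)
        then have "real (card X) \<le> 1 / a" using assms by (simp add: field_simps)
        then show "card X \<le> nat \<lfloor>1 / a\<rfloor>" by linarith
      qed
      show "\<forall>A\<in>nbhd G ` pverts G. \<forall>B\<in>nbhd G ` pverts G. A \<noteq> B \<longrightarrow>
          a * real (card (pverts G)) \<le> real (card ((A - B) \<union> (B - A)))"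
        using nbhds_separated by blast
      show "nbhd G ` pverts G \<subseteq> Pow (pverts G)" using nbhd_sub by blast
    qed (use nonempty pair_finite_verts in auto)
  qed
next
  case False
  have "\<not> dense_codegree_graph G a" for G :: "'a pair_pre_digraph"
  proof
    assume "dense_codegree_graph G a"
    then interpret dense_codegree_graph G a .
    obtain v where v: "v \<in> pverts G" using nonempty by blast
    have "a * real (card (pverts G)) \<le> real (card (nbhd G v \<inter> nbhd G v))"
      using v no_loops' by (intro codegree) auto
    also have "\<dots> \<le> real (card (pverts G))"
      using nbhd_sub pair_finite_verts by (simp add: card_mono)
    finally have "a * real (card (pverts G)) \<le> real (card (pverts G))" .
    moreover have "real (card (pverts G)) > 0"
      using v pair_finite_verts by (auto simp: card_gt_0_iff)
    ultimately show False using False by simp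
  qed
  then show ?thesis by blast
qed

section \<open>Linear programs over an ordered field\<close>

text \<open>
  The parameter \<open>t\<close>, which is to be maximized, is kept apart from the variables \<open>x\<close>, so that the
  variables can be eliminated one after another until conditions on \<open>t\<close> alone remain.
\<close>
definition param_polyhedral ::
    "'i set \<Rightarrow> (('i \<Rightarrow> 'a :: linordered_field) \<Rightarrow> 'a \<Rightarrow> bool) \<Rightarrow> bool" where
  "param_polyhedral I Q \<longleftrightarrow> (\<exists>C. finite C \<and>
     (\<forall>x t. Q x t \<longleftrightarrow> (\<forall>(c, p, q)\<in>C. (\<Sum>i\<in>I. c i * x i) \<le> p * t + q)))"

lemma param_polyhedral_conj:
  assumes "param_polyhedral I Q" and "param_polyhedral I R"
  shows "param_polyhedral I (\<lambda>x t. Q x t \<and> R x t)"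
proof -
  obtain C D where "finite C" "finite D"
    and "\<forall>x t. Q x t \<longleftrightarrow> (\<forall>(c, p, q)\<in>C. (\<Sum>i\<in>I. c i * x i) \<le> p * t + q)"
    and "\<forall>x t. R x t \<longleftrightarrow> (\<forall>(c, p, q)\<in>D. (\<Sum>i\<in>I. c i * x i) \<le> p * t + q)"
    using assms unfolding param_polyhedral_def by blast
  then show ?thesis
    unfolding param_polyhedral_def by (intro exI[of _ "C \<union> D"]) (simp add: ball_Un)
qed

lemma param_polyhedral_ball:
  assumes "finite S" and "\<And>s. s \<in> S \<Longrightarrow> param_polyhedral I (Q s)"
  shows "param_polyhedral I (\<lambda>x t. \<forall>s\<in>S. Q s x t)"
  using assms
proof (induction S rule: finite_induct)
  case empty
  show ?case unfolding param_polyhedral_def by (intro exI[of _ "{}"]) simp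
next
  case (insert s S)
  then have "param_polyhedral I (\<lambda>x t. Q s x t \<and> (\<forall>s\<in>S. Q s x t))"
    by (intro param_polyhedral_conj) auto
  then show ?case by simp
qed

lemma param_polyhedral_imp:
  assumes "P \<Longrightarrow> param_polyhedral I Q"
  shows "param_polyhedral I (\<lambda>x t. P \<longrightarrow> Q x t)"
proof (cases P)
  case False
  then show ?thesis unfolding param_polyhedral_def by (intro exI[of _ "{}"]) simp
qed (use assms in simp)

lemma param_polyhedral_sum_le:
  assumes "finite I" and "J \<subseteq> I"
  shows "param_polyhedral I (\<lambda>x t. b * (\<Sum>i\<in>J. x i) \<le> p * t + q)"
  unfolding param_polyhedral_def
proof (intro exI[of _ "{(\<lambda>i. if i \<in> J then b else 0, p, q)}"] conjI allI)
  fix x :: "'a \<Rightarrow> 'b" and t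
  have "(\<Sum>i\<in>I. (if i \<in> J then b else 0) * x i) = (\<Sum>i\<in>J. b * x i)"
    using assms by (intro sum.mono_neutral_cong_right) auto
  then show "b * (\<Sum>i\<in>J. x i) \<le> p * t + q \<longleftrightarrow>
      (\<forall>(c, p, q)\<in>{(\<lambda>i. if i \<in> J then b else 0, p, q)}. (\<Sum>i\<in>I. c i * x i) \<le> p * t + q)"
    by (simp add: sum_distrib_left)
qed simp

lemma exists_between_finite_sets:
  fixes L U :: "'a :: linordered_field set"
  assumes "finite L" and "finite U" and "\<And>l u. l \<in> L \<Longrightarrow> u \<in> U \<Longrightarrow> l \<le> u"
  shows "\<exists>y. (\<forall>l\<in>L. l \<le> y) \<and> (\<forall>u\<in>U. y \<le> u)"
proof (cases "L = {}")
  case True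
  then show ?thesis using assms(2) by (cases "U = {}") (auto intro!: exI[of _ "Min U"])
next
  case False
  then show ?thesis using assms by (intro exI[of _ "Max L"]) simp
qed

text \<open>
  One step of Fourier-Motzkin elimination. A constraint in which the variable \<open>j\<close> has a positive
  coefficient bounds it from above, one with a negative coefficient bounds it from below, and a value
  for it exists iff every lower bound is at most every upper bound. Clearing denominators in these
  comparisons gives linear constraints without \<open>j\<close>.
\<close>
lemma eliminate_variable:
  fixes C :: "(('i \<Rightarrow> 'a) \<times> 'a \<times> 'a :: linordered_field) set"
  assumes finI: "finite I" and j: "j \<notin> I" and finC: "finite C"
  shows "\<exists>D. finite D \<and> (\<forall>x t. (\<forall>(c, p, q)\<in>D. (\<Sum>i\<in>I. c i * x i) \<le> p * t + q) \<longleftrightarrow>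
    (\<exists>y. \<forall>(c, p, q)\<in>C. (\<Sum>i\<in>I. c i * x i) + c j * y \<le> p * t + q))"
proof -
  define comb where "comb = (\<lambda>((c, p, q), (c', p', q')).
    (\<lambda>i :: 'i. c i * (- c' j :: 'a) + c' i * c j, p * (- c' j) + p' * c j, q * (- c' j) + q' * c j))"
  define Pos where "Pos = {(c, p, q) \<in> C. c j > 0}"
  define Neg where "Neg = {(c, p, q) \<in> C. c j < 0}"
  define Zero where "Zero = {(c, p, q) \<in> C. c j = 0}"
  have fin: "finite Pos" "finite Neg" "finite Zero"
    using finC by (auto simp: Pos_def Neg_def Zero_def intro: finite_subset[OF _ finC])
  show ?thesis
  proof (intro exI[of _ "Zero \<union> comb ` (Pos \<times> Neg)"] conjI allI)
    show "finite (Zero \<union> comb ` (Pos \<times> Neg))" using fin by simp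
    fix x :: "'i \<Rightarrow> 'a" and t
    define slack where "slack = (\<lambda>(c, p, q). p * t + q - (\<Sum>i\<in>I. c i * x i))"
    define bound where "bound = (\<lambda>e. slack e / fst e j)"
    have comb_iff: "(case comb (e, f) of (c, p, q) \<Rightarrow> (\<Sum>i\<in>I. c i * x i) \<le> p * t + q) \<longleftrightarrow>
        bound f \<le> bound e" if "e \<in> Pos" "f \<in> Neg" for e f
    proof -
      obtain c p q c' p' q' where ef: "e = (c, p, q)" "f = (c', p', q')" by (metis prod_cases3)
      have sg: "c j > 0" "c' j < 0" using that ef by (auto simp: Pos_def Neg_def)
      have "(case comb (e, f) of (c, p, q) \<Rightarrow> (\<Sum>i\<in>I. c i * x i) \<le> p * t + q) \<longleftrightarrow>
          0 \<le> slack e * (- c' j) + slack f * c j"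
      proof -
        have comb_sum: "(\<Sum>i\<in>I. (c i * (- c' j) + c' i * c j) * x i)
            = (- c' j) * (\<Sum>i\<in>I. c i * x i) + c j * (\<Sum>i\<in>I. c' i * x i)"
          unfolding sum_distrib_left sum.distrib[symmetric]
          by (intro sum.cong refl) (simp add: algebra_simps)
        show ?thesis
          by (simp only: ef comb_def slack_def prod.case comb_sum) (simp add: algebra_simps)
      qed
      also have "\<dots> \<longleftrightarrow> bound f \<le> bound e"
        using sg by (simp add: bound_def ef field_simps)
      finally show ?thesis .
    qed
    have constr: "(case e of (c, p, q) \<Rightarrow> (\<Sum>i\<in>I. c i * x i) + c j * y \<le> p * t + q) \<longleftrightarrow>
        fst e j * y \<le> slack e" for e y
      by (cases e) (auto simp: slack_def algebra_simps)
    have pos: "fst e j * y \<le> slack e \<longleftrightarrow> y \<le> bound e" if "e \<in> Pos" for e y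
      using that by (auto simp: Pos_def bound_def field_simps)
    have neg: "fst e j * y \<le> slack e \<longleftrightarrow> bound e \<le> y" if "e \<in> Neg" for e y
      using that by (auto simp: Neg_def bound_def field_simps)
    have C: "C = Zero \<union> Pos \<union> Neg" by (auto simp: Pos_def Neg_def Zero_def)
    have zero: "fst e j = 0" if "e \<in> Zero" for e using that by (auto simp: Zero_def)
    have "(\<exists>y. \<forall>(c, p, q)\<in>C. (\<Sum>i\<in>I. c i * x i) + c j * y \<le> p * t + q) \<longleftrightarrow>
        (\<exists>y. \<forall>e\<in>C. fst e j * y \<le> slack e)"
      by (intro ex_cong1 ball_cong refl) (rule constr)
    also have "\<dots> \<longleftrightarrow> (\<forall>e\<in>Zero. 0 \<le> slack e) \<and>
        (\<exists>y. (\<forall>f\<in>Neg. bound f \<le> y) \<and> (\<forall>e\<in>Pos. y \<le> bound e))"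
      unfolding C by (simp add: ball_Un zero pos neg) blast
    also have "(\<exists>y. (\<forall>f\<in>Neg. bound f \<le> y) \<and> (\<forall>e\<in>Pos. y \<le> bound e)) \<longleftrightarrow>
        (\<forall>e\<in>Pos. \<forall>f\<in>Neg. bound f \<le> bound e)"
    proof
      assume "\<forall>e\<in>Pos. \<forall>f\<in>Neg. bound f \<le> bound e"
      then show "\<exists>y. (\<forall>f\<in>Neg. bound f \<le> y) \<and> (\<forall>e\<in>Pos. y \<le> bound e)"
        using exists_between_finite_sets[of "bound ` Neg" "bound ` Pos"] fin by auto
    qed (meson order_trans)
    also have "(\<forall>e\<in>Zero. 0 \<le> slack e) \<and> (\<forall>e\<in>Pos. \<forall>f\<in>Neg. bound f \<le> bound e) \<longleftrightarrow>
        (\<forall>(c, p, q)\<in>Zero \<union> comb ` (Pos \<times> Neg). (\<Sum>i\<in>I. c i * x i) \<le> p * t + q)"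
    proof -
      have "(\<forall>e\<in>Zero. 0 \<le> slack e) \<longleftrightarrow>
          (\<forall>(c, p, q)\<in>Zero. (\<Sum>i\<in>I. c i * x i) \<le> p * t + q)"
        by (intro ball_cong refl) (auto simp: slack_def)
      moreover have "(\<forall>e\<in>Pos. \<forall>f\<in>Neg. bound f \<le> bound e) \<longleftrightarrow>
          (\<forall>(c, p, q)\<in>comb ` (Pos \<times> Neg). (\<Sum>i\<in>I. c i * x i) \<le> p * t + q)"
        (is "?L \<longleftrightarrow> (\<forall>g\<in>_. ?sat g)")
      proof -
        have "(\<forall>g\<in>comb ` (Pos \<times> Neg). \<Phi> g) \<longleftrightarrow> (\<forall>e\<in>Pos. \<forall>f\<in>Neg. \<Phi> (comb (e, f)))" for \<Phi>
          by blast
        from this[of ?sat] show ?thesis by (simp add: comb_iff)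
      qed
      ultimately show ?thesis by (simp only: ball_Un)
    qed
    finally show "(\<forall>(c, p, q)\<in>Zero \<union> comb ` (Pos \<times> Neg). (\<Sum>i\<in>I. c i * x i) \<le> p * t + q) \<longleftrightarrow>
      (\<exists>y. \<forall>(c, p, q)\<in>C. (\<Sum>i\<in>I. c i * x i) + c j * y \<le> p * t + q)" by (rule sym)
  qed
qed

lemma param_polyhedral_projection:
  fixes Q :: "('i \<Rightarrow> 'a :: linordered_field) \<Rightarrow> 'a \<Rightarrow> bool"
  assumes "finite I" and "param_polyhedral I Q"
  shows "\<exists>D. finite D \<and> (\<forall>t. (\<exists>x. Q x t) \<longleftrightarrow> (\<forall>(p, q)\<in>D. 0 \<le> p * t + q))"
  using assms
proof (induction I arbitrary: Q rule: finite_induct)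
  case empty
  then obtain C where "finite C"
    and "\<forall>x t. Q x t \<longleftrightarrow> (\<forall>(c, p, q)\<in>C. (\<Sum>i\<in>{}. c i * x i) \<le> p * t + q)"
    unfolding param_polyhedral_def by blast
  then show ?case by (intro exI[of _ "snd ` C"]) (auto simp: case_prod_unfold)
next
  case (insert j I)
  obtain C where C: "finite C"
    "\<And>x t. Q x t \<longleftrightarrow> (\<forall>(c, p, q)\<in>C. (\<Sum>i\<in>insert j I. c i * x i) \<le> p * t + q)"
    using insert.prems unfolding param_polyhedral_def by blast
  obtain D where D: "finite D"
    "\<And>x t. (\<forall>(c, p, q)\<in>D. (\<Sum>i\<in>I. c i * x i) \<le> p * t + q) \<longleftrightarrow>
      (\<exists>y. \<forall>(c, p, q)\<in>C. (\<Sum>i\<in>I. c i * x i) + c j * y \<le> p * t + q)"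
    using eliminate_variable[OF insert.hyps C(1)] by blast
  define R where "R x t \<longleftrightarrow> (\<forall>(c, p, q)\<in>D. (\<Sum>i\<in>I. c i * x i) \<le> p * t + q)" for x t
  have Q: "Q (x(j := y)) t \<longleftrightarrow> (\<forall>(c, p, q)\<in>C. (\<Sum>i\<in>I. c i * x i) + c j * y \<le> p * t + q)"
    for x y t
  proof -
    have "(\<Sum>i\<in>insert j I. c i * (x(j := y)) i) = (\<Sum>i\<in>I. c i * x i) + c j * y" for c
    proof -
      have "(\<Sum>i\<in>I. c i * (x(j := y)) i) = (\<Sum>i\<in>I. c i * x i)"
        using insert.hyps(2) by (intro sum.cong) auto
      then show ?thesis using insert.hyps by (simp add: add.commute)
    qed
    then show ?thesis by (simp only: C(2))
  qed
  have "(\<exists>x. Q x t) \<longleftrightarrow> (\<exists>x. R x t)" for t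
  proof
    assume "\<exists>x. Q x t"
    then obtain x where "Q x t" ..
    then have "Q (x(j := x j)) t" by simp
    then show "\<exists>x. R x t" unfolding R_def D(2) Q by blast
  next
    assume "\<exists>x. R x t"
    then show "\<exists>x. Q x t" unfolding R_def D(2) Q[symmetric] by blast
  qed
  moreover have "param_polyhedral I R"
    unfolding param_polyhedral_def R_def using D(1) by blast
  ultimately show ?case using insert.IH[of R] by simp
qed

text \<open>
  After elimination, the feasible values of \<open>t\<close> are cut out by finitely many weak inequalities
  \<open>0 \<le> p * t + q\<close>; boundedness means that some of them have \<open>p < 0\<close>, and the smallest of the resulting
  upper bounds is itself feasible. It is a quotient of coefficients, so that over the rationals the
  optimum is reached at a rational point.
\<close>
lemma param_polyhedral_attains_max:
  fixes Q :: "('i \<Rightarrow> 'a :: linordered_field) \<Rightarrow> 'a \<Rightarrow> bool"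
  assumes "finite I" and "param_polyhedral I Q"
    and feasible: "Q x\<^sub>0 t\<^sub>0" and bdd: "\<And>x t. Q x t \<Longrightarrow> t \<le> B"
  shows "\<exists>x t. Q x t \<and> (\<forall>x' t'. Q x' t' \<longrightarrow> t' \<le> t)"
proof -
  obtain D where D: "finite D" "\<And>t. (\<exists>x. Q x t) \<longleftrightarrow> (\<forall>(p, q)\<in>D. 0 \<le> p * t + q)"
    using param_polyhedral_projection[OF assms(1,2)] by blast
  define U where "U = (\<lambda>(p, q). q / (- p)) ` {(p, q) \<in> D. p < 0}"
  have finU: "finite U" unfolding U_def
    by (rule finite_imageI, rule finite_subset[OF _ D(1)]) auto
  have t0: "\<forall>(p, q)\<in>D. 0 \<le> p * t\<^sub>0 + q" using feasible D(2) by blast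
  have sat: "\<exists>x. Q x t" if "t\<^sub>0 \<le> t" "\<And>u. u \<in> U \<Longrightarrow> t \<le> u" for t
    unfolding D(2)
  proof clarify
    fix p q assume pq: "(p, q) \<in> D"
    show "0 \<le> p * t + q"
    proof (cases "p < 0")
      case True
      with pq have "q / (- p) \<in> U" unfolding U_def by force
      with that(2) have "t \<le> q / (- p)" by blast
      with True show ?thesis by (simp add: field_simps)
    next
      case False
      then have "p * t\<^sub>0 \<le> p * t" using that(1) by (intro mult_left_mono) auto
      moreover have "0 \<le> p * t\<^sub>0 + q" using t0 pq by auto
      ultimately show ?thesis by simp
    qed
  qed
  have upper: "t \<le> u" if Q: "Q x t" and u: "u \<in> U" for x t u
  proof -
    obtain p q where pq: "(p, q) \<in> D" "p < 0" "u = q / (- p)" using u by (auto simp: U_def)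
    have "0 \<le> p * t + q" using D(2)[of t] Q pq(1) by blast
    then have "t * (- p) \<le> q" by (simp add: mult.commute)
    with pq(2,3) show ?thesis by (simp only: pos_le_divide_eq neg_0_less_iff_less)
  qed
  have "U \<noteq> {}"
  proof
    assume "U = {}"
    then obtain x where "Q x (max t\<^sub>0 (B + 1))" using sat[of "max t\<^sub>0 (B + 1)"] by auto
    then have "max t\<^sub>0 (B + 1) \<le> B" by (rule bdd)
    then show False by simp
  qed
  then have Min: "Min U \<in> U" using finU by simp
  have "\<exists>x. Q x (Min U)" using upper[OF feasible Min] finU by (intro sat) auto
  then show ?thesis using upper[OF _ Min] by blast
qed

section \<open>Weighted patterns and their blow-ups\<close>

text \<open>
  A pattern is a finite triangle-free graph, given by its vertex set and its adjacency relation.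
  The last condition excludes loops as well, through \<open>i = j = l\<close>.
\<close>
definition pattern :: "'b set \<Rightarrow> ('b \<times> 'b) set \<Rightarrow> bool" where
  "pattern S P \<longleftrightarrow> finite S \<and> P \<subseteq> S \<times> S \<and> sym P \<and>
     \<not> (\<exists>i j l. (i, j) \<in> P \<and> (j, l) \<in> P \<and> (l, i) \<in> P)"

text \<open>
  These are the conditions under which a blow-up of the pattern, with \<open>i\<close> replaced by a fraction \<open>w i\<close>
  of all vertices, is regular of density \<open>r\<close> with codegree density at least \<open>t\<close>. Weights may vanish:
  this keeps all constraints weak, as the attainment of the optimum requires, and a pattern vertex of
  weight zero merely disappears from the blow-up.
\<close>
definition weighting ::
    "rat \<Rightarrow> 'b set \<Rightarrow> ('b \<times> 'b) set \<Rightarrow> ('b \<Rightarrow> rat) \<Rightarrow> rat \<Rightarrow> bool" where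
  "weighting r S P w t \<longleftrightarrow> (\<forall>i\<in>S. 0 \<le> w i) \<and> sum w S = 1 \<and>
     (\<forall>i\<in>S. sum w {l \<in> S. (i, l) \<in> P} = r) \<and>
     (\<forall>i\<in>S. \<forall>j\<in>S. (i, j) \<notin> P \<longrightarrow> t \<le> sum w {l \<in> S. (i, l) \<in> P \<and> (j, l) \<in> P})"

lemma pattern_irrefl: "pattern S P \<Longrightarrow> (i, i) \<notin> P"
  unfolding pattern_def by blast

lemma weighting_param_polyhedral:
  assumes "finite S"
  shows "param_polyhedral S (weighting r S P)"
proof -
  have eq: "param_polyhedral S (\<lambda>w t. sum w J = b)" if "J \<subseteq> S" for J and b :: rat
  proof -
    have "param_polyhedral S (\<lambda>w t. 1 * sum w J \<le> 0 * t + b \<and> (- 1) * sum w J \<le> 0 * t + (- b))"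
      by (intro param_polyhedral_conj param_polyhedral_sum_le assms that)
    moreover have "(1 * sum w J \<le> 0 * t + b \<and> (- 1) * sum w J \<le> 0 * t + (- b)) \<longleftrightarrow> sum w J = b"
      for w :: "'a \<Rightarrow> rat" and t by auto
    ultimately show ?thesis by simp
  qed
  have ge: "param_polyhedral S (\<lambda>w (t :: rat). t \<le> sum w J)" if "J \<subseteq> S" for J
    using param_polyhedral_sum_le[OF assms that, of "- 1 :: rat" "- 1" 0] by simp
  have nonneg: "param_polyhedral S (\<lambda>w t :: rat. 0 \<le> w i)" if "i \<in> S" for i
    using param_polyhedral_sum_le[OF assms, of "{i}" "- 1 :: rat" 0 0] that by simp
  show ?thesis
    unfolding weighting_def
    by (intro param_polyhedral_conj param_polyhedral_ball param_polyhedral_imp assms nonneg eq ge)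
      auto
qed

text \<open>
  The diagonal pairs bound the codegree by the degree.
\<close>
lemma weighting_bounded:
  assumes "pattern S P" and "weighting r S P w t"
  shows "t \<le> r"
proof -
  have "S \<noteq> {}" using assms(2) by (auto simp: weighting_def)
  then obtain i where i: "i \<in> S" by blast
  with assms pattern_irrefl[OF assms(1)] have "t \<le> sum w {l \<in> S. (i, l) \<in> P \<and> (i, l) \<in> P}"
    unfolding weighting_def by blast
  also have "\<dots> = r" using assms(2) i by (simp add: weighting_def)
  finally show ?thesis .
qed

lemma best_weighting_exists:
  assumes "pattern S P" and "weighting r S P w\<^sub>0 t\<^sub>0"
  shows "\<exists>w t. weighting r S P w t \<and> (\<forall>w' t'. weighting r S P w' t' \<longrightarrow> t' \<le> t)"
proof (rule param_polyhedral_attains_max)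
  show "finite S" using assms(1) by (simp add: pattern_def)
  then show "param_polyhedral S (weighting r S P)" by (rule weighting_param_polyhedral)
  show "weighting r S P w\<^sub>0 t\<^sub>0" by fact
  show "t \<le> r" if "weighting r S P w t" for w t using weighting_bounded[OF assms(1) that] .
qed

lemma codeg_density_ge_iff:
  assumes "pair_graph G" and "pverts G \<noteq> {}"
  shows "c \<le> codeg_density G \<longleftrightarrow> (\<forall>u\<in>pverts G. \<forall>v\<in>pverts G. (u, v) \<notin> parcs G \<longrightarrow>
    c * real (card (pverts G)) \<le> real (card (nbhd G u \<inter> nbhd G v)))"
proof -
  interpret pair_graph G by fact
  let ?A = "{real (card (nbhd G u \<inter> nbhd G v)) / real (card (pverts G)) | u v.
     u \<in> pverts G \<and> v \<in> pverts G \<and> (u, v) \<notin> parcs G}"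
  have n: "real (card (pverts G)) > 0"
    using assms(2) pair_finite_verts by (simp add: card_gt_0_iff)
  obtain v where v: "v \<in> pverts G" using assms(2) by blast
  have "(v, v) \<notin> parcs G" using no_loops' by blast
  with v have "?A \<noteq> {}" by blast
  then have "c \<le> codeg_density G \<longleftrightarrow> (\<forall>x\<in>?A. c \<le> x)"
    unfolding codeg_density_def using codeg_set_finite[OF pair_finite_verts] by (intro Min_ge_iff)
  also have "\<dots> \<longleftrightarrow> (\<forall>u\<in>pverts G. \<forall>v\<in>pverts G. (u, v) \<notin> parcs G \<longrightarrow>
      c \<le> real (card (nbhd G u \<inter> nbhd G v)) / real (card (pverts G)))" by blast
  finally show ?thesis using n by (simp add: pos_le_divide_eq)
qed

lemma common_denominator:
  fixes w :: "'b \<Rightarrow> rat"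
  assumes "finite S"
  shows "\<exists>N>0. \<forall>i\<in>S. w i * of_nat N \<in> \<int>"
  using assms
proof (induction S rule: finite_induct)
  case empty
  show ?case by (intro exI[of _ 1]) simp
next
  case (insert s S)
  then obtain N where N: "N > 0" "\<forall>i\<in>S. w i * of_nat N \<in> \<int>" by blast
  obtain p q where pq: "w s = Fract p q" "q > 0" by (cases "w s") auto
  then have s: "w s * of_nat (nat q) = of_int p" by (simp add: Fract_of_int_quotient)
  have "w i * of_nat (N * nat q) \<in> \<int>" if "i \<in> insert s S" for i
  proof (cases "i = s")
    case True
    have "w s * of_nat (N * nat q) = of_int p * of_nat N" using s by (simp add: mult_ac)
    then have "w s * of_nat (N * nat q) \<in> \<int>" by (simp only: Ints_mult Ints_of_int Ints_of_nat)
    with True show ?thesis by (simp only:)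
  next
    case False
    with that N(2) have "w i * of_nat N \<in> \<int>" by blast
    then have "w i * of_nat N * of_nat (nat q) \<in> \<int>" by (rule Ints_mult) (rule Ints_of_nat)
    then show ?thesis by (simp add: mult_ac)
  qed
  then show ?case using N(1) pq(2) by (intro exI[of _ "N * nat q"]) auto
qed

text \<open>
  With a common denominator \<open>N\<close> of the weights, the pattern vertex \<open>i\<close> is replaced by \<open>w i * N\<close>
  independent copies. Only an inequality for the codegree density can be expected, since the pairs of
  pattern vertices of weight zero constrain \<open>t\<close> without occurring in the graph.
\<close>
lemma blow_up:
  fixes S :: "'b set"
  assumes pat: "pattern S P" and wt: "weighting r S P w t"
  shows "\<exists>G :: nat pair_pre_digraph. admissible (of_rat r) G \<and> of_rat t \<le> codeg_density G"
proof -
  have finS: "finite S" and symP: "sym P"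
    and tri: "\<And>i j l. (i, j) \<in> P \<Longrightarrow> (j, l) \<in> P \<Longrightarrow> (l, i) \<notin> P"
    using pat unfolding pattern_def by blast+
  obtain N where N: "N > 0" "\<forall>i\<in>S. w i * of_nat N \<in> \<int>"
    using common_denominator[OF finS] by blast
  define m where "m i = nat \<lfloor>w i * of_nat N\<rfloor>" for i
  have m: "of_nat (m i) = w i * of_nat N" if "i \<in> S" for i
  proof -
    have "0 \<le> w i * of_nat N" using wt that by (simp add: weighting_def)
    moreover have "of_int \<lfloor>w i * of_nat N\<rfloor> = w i * of_nat N" using N(2) that by simp
    ultimately show ?thesis by (simp add: m_def)
  qed
  have sum_m: "real (\<Sum>i\<in>J. m i) = of_rat (sum w J) * real N" if "J \<subseteq> S" for J
  proof -
    have "(of_nat (\<Sum>i\<in>J. m i) :: rat) = (\<Sum>i\<in>J. w i * of_nat N)"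
      using that m by (auto intro!: sum.cong)
    also have "\<dots> = sum w J * of_nat N" by (simp add: sum_distrib_right)
    finally have "of_rat (of_nat (\<Sum>i\<in>J. m i)) = (of_rat (sum w J * of_nat N) :: real)" by simp
    then show ?thesis by (simp add: of_rat_mult of_rat_sum)
  qed
  define V where "V J = Sigma J (\<lambda>i. {..<m i})" for J
  define G where "G = \<lparr> pverts = V S,
    parcs = {((i, k), (j, l)). (i, k) \<in> V S \<and> (j, l) \<in> V S \<and> (i, j) \<in> P} \<rparr>"
  have cardV: "real (card (V J)) = of_rat (sum w J) * real N" if "J \<subseteq> S" for J
    using sum_m[OF that] finite_subset[OF that finS] by (simp add: V_def)
  have verts: "pverts G = V S" by (simp add: G_def)
  have cardG: "real (card (pverts G)) = real N"
    using cardV[of S] wt by (simp add: verts weighting_def)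
  have ne: "pverts G \<noteq> {}" using cardG N(1) by auto
  have nb: "nbhd G u = V {j \<in> S. (fst u, j) \<in> P}" if "u \<in> pverts G" for u
    using that by (auto simp: nbhd_def G_def V_def)
  have finV: "finite (V S)" using finS by (simp add: V_def)
  have pg: "pair_graph G"
  proof unfold_locales
    show "finite (pverts G)" using finV by (simp add: verts)
    show "finite (parcs G)"
      by (rule finite_subset[of _ "V S \<times> V S"]) (use finV in \<open>auto simp: G_def\<close>)
    fix e assume "e \<in> parcs G"
    then show "fst e \<in> pverts G" "snd e \<in> pverts G" "fst e \<noteq> snd e"
      using pattern_irrefl[OF pat] by (auto simp: G_def)
  next
    show "symmetric (with_proj G)" unfolding symmetric_def
      by (rule symI) (use symP in \<open>auto simp: G_def dest: symD\<close>)
  qed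
  have tf: "triangle_free G"
    unfolding triangle_free_def
  proof clarify
    fix u v x assume "(u, v) \<in> parcs G" "(v, x) \<in> parcs G" "(x, u) \<in> parcs G"
    then have "(fst u, fst v) \<in> P" "(fst v, fst x) \<in> P" "(fst x, fst u) \<in> P"
      by (auto simp: G_def)
    with tri show False by blast
  qed
  have "rho_regular (of_rat r) G"
    unfolding rho_regular_iff[OF pg ne]
  proof
    fix u assume u: "u \<in> pverts G"
    then have "fst u \<in> S" by (auto simp: verts V_def)
    with wt have "sum w {j \<in> S. (fst u, j) \<in> P} = r" by (simp add: weighting_def)
    then show "real (card (nbhd G u)) = of_rat r * real (card (pverts G))"
      using cardV[of "{j \<in> S. (fst u, j) \<in> P}"] by (simp add: nb[OF u] cardG)
  qed
  then have adm: "admissible (of_rat r) G" using pg ne tf by (simp add: admissible_def)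
  have "of_rat t \<le> codeg_density G"
    unfolding codeg_density_ge_iff[OF pg ne]
  proof (intro ballI impI)
    fix u v assume uv: "u \<in> pverts G" "v \<in> pverts G" "(u, v) \<notin> parcs G"
    then have S: "fst u \<in> S" "fst v \<in> S" "(fst u, fst v) \<notin> P"
      by (auto simp: G_def V_def)
    let ?J = "{l \<in> S. (fst u, l) \<in> P \<and> (fst v, l) \<in> P}"
    have "nbhd G u \<inter> nbhd G v = V ?J"
      unfolding nb[OF uv(1)] nb[OF uv(2)] by (auto simp: V_def)
    then have "real (card (nbhd G u \<inter> nbhd G v)) = of_rat (sum w ?J) * real N"
      using cardV[of ?J] by simp
    moreover have "t \<le> sum w ?J" using wt S unfolding weighting_def by blast
    ultimately show "of_rat t * real (card (pverts G)) \<le> real (card (nbhd G u \<inter> nbhd G v))"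
      unfolding cardG by (simp add: mult_right_mono of_rat_less_eq)
  qed
  moreover obtain H :: "nat pair_pre_digraph"
    where "admissible (of_rat r) H" "codeg_density H = codeg_density G"
    using admissible_nat_copy[OF adm] by blast
  ultimately show ?thesis by auto
qed

text \<open>
  Adjacency of two vertices depends on their neighbourhoods only, so the classes of vertices with
  equal neighbourhoods form a pattern, weighted by the relative sizes of the classes. Neighbourhoods
  and their intersections are unions of classes, which turns cardinalities into sums of weights.
\<close>
lemma twin_reduction:
  assumes adm: "admissible (of_rat r) G" and k: "k = card (nbhd G ` pverts G)"
    and t: "of_rat t \<le> codeg_density G"
  shows "\<exists>P w. pattern {..<k} P \<and> weighting r {..<k} P w t"
proof -
  have pg: "pair_graph G" and ne: "pverts G \<noteq> {}" and tf: "triangle_free G"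
    and rr: "rho_regular (of_rat r) G" using adm by (auto simp: admissible_def)
  interpret pair_graph G by fact
  obtain h where h: "bij_betw h (nbhd G ` pverts G) {..<k}"
    using ex_bij_betw_finite_nat[of "nbhd G ` pverts G"] pair_finite_verts
    by (auto simp: k atLeast0LessThan)
  define \<phi> where "\<phi> v = h (nbhd G v)" for v
  have onto: "\<phi> ` pverts G = {..<k}"
    using h by (simp add: \<phi>_def bij_betw_def flip: image_image)
  have twins: "nbhd G u = nbhd G v" if "u \<in> pverts G" "v \<in> pverts G" "\<phi> u = \<phi> v" for u v
    using that h unfolding \<phi>_def bij_betw_def by (meson imageI inj_onD)
  define P where "P = map_prod \<phi> \<phi> ` parcs G"
  have P: "(\<phi> u, \<phi> v) \<in> P \<longleftrightarrow> (u, v) \<in> parcs G" if uv: "u \<in> pverts G" "v \<in> pverts G" for u v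
  proof
    assume "(\<phi> u, \<phi> v) \<in> P"
    then obtain u' v' where e: "(u', v') \<in> parcs G" "\<phi> u = \<phi> u'" "\<phi> v = \<phi> v'"
      by (auto simp: P_def)
    have "nbhd G u = nbhd G u'" "nbhd G v = nbhd G v'"
      using twins uv e in_arcsD1[OF e(1)] in_arcsD2[OF e(1)] by blast+
    with e(1) have "(u, v') \<in> parcs G" by (auto simp: nbhd_def)
    then have "u \<in> nbhd G v'" using arcs_symmetric by (simp add: nbhd_def)
    then have "(v, u) \<in> parcs G" using \<open>nbhd G v = nbhd G v'\<close> by (auto simp: nbhd_def)
    then show "(u, v) \<in> parcs G" by (rule arcs_symmetric)
  qed (auto simp: P_def)
  have PE: "\<exists>u v. i = \<phi> u \<and> j = \<phi> v \<and> u \<in> pverts G \<and> v \<in> pverts G \<and> (u, v) \<in> parcs G"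
    if "(i, j) \<in> P" for i j
    using that in_arcsD1 in_arcsD2 unfolding P_def by fastforce
  have pat: "pattern {..<k} P"
    unfolding pattern_def
  proof (intro conjI)
    show "P \<subseteq> {..<k} \<times> {..<k}" using PE onto by fast
    show "sym P"
    proof (rule symI)
      fix i j assume "(i, j) \<in> P"
      with PE obtain u v where "i = \<phi> u" "j = \<phi> v" "(u, v) \<in> parcs G" by blast
      with arcs_symmetric show "(j, i) \<in> P" unfolding P_def by force
    qed
    show "\<nexists>i j l. (i, j) \<in> P \<and> (j, l) \<in> P \<and> (l, i) \<in> P"
    proof clarify
      fix i j l assume a: "(i, j) \<in> P" "(j, l) \<in> P" "(l, i) \<in> P"
      obtain u v x where "i = \<phi> u" "j = \<phi> v" "l = \<phi> x"
        "u \<in> pverts G" "v \<in> pverts G" "x \<in> pverts G"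
        using PE[OF a(1)] PE[OF a(2)] by blast
      with a P have "(u, v) \<in> parcs G" "(v, x) \<in> parcs G" "(x, u) \<in> parcs G" by simp_all
      with tf show False unfolding triangle_free_def by blast
    qed
  qed simp
  define n :: rat where "n = of_nat (card (pverts G))"
  have n: "n > 0" using ne pair_finite_verts by (simp add: n_def card_gt_0_iff)
  define w :: "nat \<Rightarrow> rat" where "w i = of_nat (card {v \<in> pverts G. \<phi> v = i}) / n" for i
  have sum_w: "sum w {l \<in> {..<k}. Q l} = of_nat (card {v \<in> pverts G. Q (\<phi> v)}) / n" for Q
  proof -
    let ?J = "{l \<in> {..<k}. Q l}"
    have "{v \<in> pverts G. Q (\<phi> v)} = (\<Union>l\<in>?J. {v \<in> pverts G. \<phi> v = l})" using onto by auto
    also have "card \<dots> = (\<Sum>l\<in>?J. card {v \<in> pverts G. \<phi> v = l})"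
      using pair_finite_verts by (intro card_UN_disjoint) auto
    finally show ?thesis by (simp add: w_def sum_divide_distrib)
  qed
  have nb: "nbhd G u = {v \<in> pverts G. (\<phi> u, \<phi> v) \<in> P}" if "u \<in> pverts G" for u
    using P that nbhd_subset[OF pg] by (auto simp: nbhd_def)
  have "weighting r {..<k} P w t"
    unfolding weighting_def
  proof (intro conjI ballI impI)
    show "0 \<le> w i" for i using n by (simp add: w_def)
    show "sum w {..<k} = 1" using sum_w[of "\<lambda>_. True"] n ne by (simp add: n_def lessThan_def)
  next
    fix i assume "i \<in> {..<k}"
    with onto obtain u where u: "u \<in> pverts G" "i = \<phi> u" by blast
    have "real (card (nbhd G u)) = of_rat r * real (card (pverts G))"
      using rr u(1) by (simp add: rho_regular_iff[OF pg ne])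
    then have "(of_rat (of_nat (card (nbhd G u))) :: real) = of_rat (r * n)"
      by (simp add: n_def of_rat_mult)
    then have "of_nat (card (nbhd G u)) = r * n" by (simp only: of_rat_eq_iff)
    then show "sum w {l \<in> {..<k}. (i, l) \<in> P} = r"
      using n unfolding sum_w u(2) nb[OF u(1), symmetric] by simp
  next
    fix i j assume "i \<in> {..<k}" "j \<in> {..<k}" and ij: "(i, j) \<notin> P"
    with onto obtain u v where u: "u \<in> pverts G" "i = \<phi> u" and v: "v \<in> pverts G" "j = \<phi> v"
      by blast
    have "(u, v) \<notin> parcs G" using ij u v P by blast
    then have "of_rat t * real (card (pverts G)) \<le> real (card (nbhd G u \<inter> nbhd G v))"
      using t u v unfolding codeg_density_ge_iff[OF pg ne] by blast
    then have "(of_rat (t * n) :: real) \<le> of_rat (of_nat (card (nbhd G u \<inter> nbhd G v)))"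
      by (simp add: n_def of_rat_mult)
    then have "t * n \<le> of_nat (card (nbhd G u \<inter> nbhd G v))" by (simp only: of_rat_less_eq)
    moreover have "nbhd G u \<inter> nbhd G v = {x \<in> pverts G. (\<phi> u, \<phi> x) \<in> P \<and> (\<phi> v, \<phi> x) \<in> P}"
      unfolding nb[OF u(1)] nb[OF v(1)] by blast
    ultimately show "t \<le> sum w {l \<in> {..<k}. (i, l) \<in> P \<and> (j, l) \<in> P}"
      using n unfolding sum_w u(2) v(2) by (simp add: pos_le_divide_eq)
  qed
  with pat show ?thesis by blast
qed

section \<open>Attainment\<close>

lemma card_residue_class_lt:
  fixes q d x :: nat
  assumes "d \<le> q"
  shows "card {y \<in> {..<q}. (x + y) mod q < d} = d"
proof (cases "q = 0")
  case False
  have inj: "inj_on (\<lambda>y. (x + y) mod q) {..<q}"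
  proof (rule inj_onI)
    fix y z assume *: "y \<in> {..<q}" "z \<in> {..<q}" "(x + y) mod q = (x + z) mod q"
    then have "[x + y = x + z] (mod q)" by (simp add: cong_def)
    then have "[y = z] (mod q)" by (simp add: cong_add_lcancel_nat)
    with * show "y = z" by (simp add: cong_def)
  qed
  have "(\<lambda>y. (x + y) mod q) ` {..<q} = {..<q}"
    by (rule card_subset_eq) (use False card_image[OF inj] in auto)
  moreover have "(\<lambda>y. (x + y) mod q) ` {y \<in> {..<q}. (x + y) mod q < d}
      = (\<lambda>y. (x + y) mod q) ` {..<q} \<inter> {..<d}" by blast
  ultimately have "(\<lambda>y. (x + y) mod q) ` {y \<in> {..<q}. (x + y) mod q < d} = {..<d}"
    using assms by auto
  moreover have "inj_on (\<lambda>y. (x + y) mod q) {y \<in> {..<q}. (x + y) mod q < d}"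
    by (rule inj_on_subset[OF inj]) auto
  ultimately show ?thesis using card_image by (metis card_lessThan)
qed (use assms in simp)

text \<open>
  For \<open>r = p / q\<close> take two copies of the residues modulo \<open>q\<close> and join \<open>x\<close> on one side to \<open>y\<close> on the
  other iff \<open>x + y\<close> is congruent to one of \<open>0, ..., 2 * p - 1\<close>. Every degree is then \<open>2 * p\<close>, which is
  at most \<open>q\<close> as \<open>r \<le> 1/2\<close>. Using the sum rather than the difference makes the relation symmetric.
\<close>
lemma admissible_exists:
  fixes r :: rat
  assumes "0 \<le> r" and "r \<le> 1/2"
  shows "\<exists>G :: nat pair_pre_digraph. admissible (of_rat r) G"
proof -
  obtain p q' where pq': "r = Fract p q'" "q' > 0" by (cases r) auto
  define q where "q = nat q'"
  define d where "d = nat (2 * p)"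
  have "0 \<le> p" using assms(1) pq' by (simp add: zero_le_Fract_iff)
  have q: "q > 0" using pq' by (simp add: q_def)
  have d: "of_nat d = 2 * r * of_nat q"
    using pq' \<open>0 \<le> p\<close> by (simp add: d_def q_def Fract_of_int_quotient)
  have "2 * r * of_nat q \<le> of_nat q" 
    using assms(2) mult_right_mono[of "2 * r" 1 "of_nat q"] by simp
  then have "d \<le> q" using d by (metis of_nat_le_iff)
  define S where "S = {..<q} \<times> (UNIV :: bool set)"
  define P where "P = {((x, a :: bool), (y, b)). x < q \<and> y < q \<and> a \<noteq> b \<and> (x + y) mod q < d}"
  define w where "w = (\<lambda>_ :: nat \<times> bool. 1 / of_nat (2 * q) :: rat)"
  have pat: "pattern S P"
    unfolding pattern_def S_def P_def by (auto simp: sym_def add.commute)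
  have "weighting r S P w 0"
    unfolding weighting_def
  proof (intro conjI ballI impI)
    show "sum w S = 1" using q by (simp add: w_def S_def card_cartesian_product)
  next
    fix u assume "u \<in> S"
    then obtain x a where u: "u = (x, a)" "x < q" by (auto simp: S_def)
    have "{l \<in> S. (u, l) \<in> P} = {y \<in> {..<q}. (x + y) mod q < d} \<times> {\<not> a}"
      using u by (auto simp: S_def P_def)
    then have "card {l \<in> S. (u, l) \<in> P} = d"
      using card_residue_class_lt[OF \<open>d \<le> q\<close>] by (simp add: card_cartesian_product)
    then show "sum w {l \<in> S. (u, l) \<in> P} = r" using q d by (simp add: w_def)
  qed (auto simp: w_def intro!: sum_nonneg)
  with blow_up[OF pat] show ?thesis by blast
qed

lemma codeg_density_rational:
  assumes "pair_graph G" and "pverts G \<noteq> {}"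
  shows "\<exists>t. codeg_density G = of_rat t"
proof -
  interpret pair_graph G by fact
  let ?A = "{real (card (nbhd G u \<inter> nbhd G v)) / real (card (pverts G)) | u v.
     u \<in> pverts G \<and> v \<in> pverts G \<and> (u, v) \<notin> parcs G}"
  obtain v where v: "v \<in> pverts G" using assms(2) by blast
  have "(v, v) \<notin> parcs G" using no_loops' by blast
  with v have "?A \<noteq> {}" by blast
  then have "codeg_density G \<in> ?A"
    unfolding codeg_density_def using codeg_set_finite[OF pair_finite_verts] by (intro Min_in)
  then have "codeg_density G \<in> \<rat>" by auto
  then show ?thesis by (auto elim: Rats_cases)
qed

text \<open>
  Only graphs at least as good as \<open>G\<^sub>0\<close> matter. Their codegree densities are bounded away from zero, so
  that they all reduce to one of the finitely many patterns in \<open>\<P>\<close>, and the blow-up of the best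
  pattern with its best weights beats each of them.
\<close>
lemma best_above_positive:
  fixes G\<^sub>0 :: "nat pair_pre_digraph"
  assumes adm: "admissible (of_rat r) G\<^sub>0" and pos: "0 < codeg_density G\<^sub>0"
  shows "\<exists>G :: nat pair_pre_digraph. admissible (of_rat r) G \<and>
    (\<forall>H :: nat pair_pre_digraph. admissible (of_rat r) H \<longrightarrow> codeg_density H \<le> codeg_density G)"
proof -
  obtain K where K: "\<And>G :: nat pair_pre_digraph. dense_codegree_graph G (codeg_density G\<^sub>0) \<Longrightarrow>
      card (nbhd G ` pverts G) \<le> K"
    using nbhd_classes_bound[OF pos] by blast
  define \<P> where "\<P> = {(k, P). k \<le> K \<and> pattern {..<k} P \<and> (\<exists>w t. weighting r {..<k} P w t)}"
  have fin: "finite \<P>"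
  proof (rule finite_subset)
    show "\<P> \<subseteq> {..K} \<times> Pow ({..<K} \<times> {..<K})"
      unfolding \<P>_def pattern_def by fastforce
  qed simp
  have "\<forall>e\<in>\<P>. \<exists>w t. weighting r {..<fst e} (snd e) w t \<and>
      (\<forall>w' t'. weighting r {..<fst e} (snd e) w' t' \<longrightarrow> t' \<le> t)"
    using best_weighting_exists unfolding \<P>_def by fastforce
  then obtain w t where wt: "\<And>e. e \<in> \<P> \<Longrightarrow> weighting r {..<fst e} (snd e) (w e) (t e)"
    and best: "\<And>e w' t'. e \<in> \<P> \<Longrightarrow> weighting r {..<fst e} (snd e) w' t' \<Longrightarrow> t' \<le> t e"
    by metis
  have reduce: "\<exists>e\<in>\<P>. codeg_density H \<le> of_rat (t e)"
    if H: "admissible (of_rat r) H" and large: "codeg_density G\<^sub>0 \<le> codeg_density H"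
    for H :: "nat pair_pre_digraph"
  proof -
    have pg: "pair_graph H" and ne: "pverts H \<noteq> {}" and tf: "triangle_free H"
      using H by (auto simp: admissible_def)
    have "dense_codegree_graph H (codeg_density G\<^sub>0)"
      using large pg ne tf unfolding codeg_density_ge_iff[OF pg ne]
      by (intro dense_codegree_graph.intro dense_codegree_graph_axioms.intro) auto
    then have le: "card (nbhd H ` pverts H) \<le> K" by (rule K)
    obtain s where s: "codeg_density H = of_rat s" using codeg_density_rational[OF pg ne] ..
    obtain P v where Pv: "pattern {..<card (nbhd H ` pverts H)} P"
        "weighting r {..<card (nbhd H ` pverts H)} P v s"
      using twin_reduction[OF H refl, of s] s by auto
    then have e: "(card (nbhd H ` pverts H), P) \<in> \<P>" using le by (auto simp: \<P>_def)
    with best[OF e, of v s] Pv(2) s show ?thesis by (intro bexI[OF _ e]) (simp add: of_rat_less_eq)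
  qed
  have ne: "\<P> \<noteq> {}" using reduce[OF adm] by blast
  then have "Max (t ` \<P>) \<in> t ` \<P>" using fin by simp
  then obtain e where e: "e \<in> \<P>" "t e = Max (t ` \<P>)" by force
  have "pattern {..<fst e} (snd e)" using e(1) by (auto simp: \<P>_def)
  from blow_up[OF this wt[OF e(1)]] obtain G :: "nat pair_pre_digraph"
    where G: "admissible (of_rat r) G" "of_rat (t e) \<le> codeg_density G" by blast
  have main: "codeg_density H \<le> codeg_density G"
    if H: "admissible (of_rat r) H" "codeg_density G\<^sub>0 \<le> codeg_density H"
    for H :: "nat pair_pre_digraph"
  proof -
    obtain f where f: "f \<in> \<P>" "codeg_density H \<le> of_rat (t f)" using reduce[OF H] ..
    have "t f \<le> t e" using f(1) fin e(2) by simp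
    then have "(of_rat (t f) :: real) \<le> of_rat (t e)" by (simp add: of_rat_less_eq)
    with f(2) G(2) show ?thesis by linarith
  qed
  have "codeg_density H \<le> codeg_density G" if "admissible (of_rat r) H"
    for H :: "nat pair_pre_digraph"
    using main[OF that] main[OF adm] by linarith
  with G(1) show ?thesis by blast
qed

theorem corollary4p5:
  fixes \<rho> :: real
  assumes "\<rho> \<in> \<rat>" and "0 \<le> \<rho>" and "\<rho> \<le> 1/2"
  shows "\<exists>G :: nat pair_pre_digraph. admissible \<rho> G \<and> codeg_density G = max_codeg_density \<rho>"
proof -
  obtain r where r: "\<rho> = of_rat r" using Rats_cases[OF assms(1)] by blast
  have "0 \<le> r" using assms(2) by (simp add: r)
  moreover have "r \<le> 1/2"
  proof -
    have "(of_rat r :: real) \<le> of_rat (1/2)" using assms(3) by (simp add: r of_rat_divide)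
    then show ?thesis by (simp only: of_rat_less_eq)
  qed
  ultimately obtain G\<^sub>0 :: "nat pair_pre_digraph" where G0: "admissible \<rho> G\<^sub>0"
    using admissible_exists unfolding r by blast
  obtain G :: "nat pair_pre_digraph" where G: "admissible \<rho> G"
    and max: "\<And>H :: nat pair_pre_digraph. admissible \<rho> H \<Longrightarrow> codeg_density H \<le> codeg_density G"
  proof (cases "\<exists>H :: nat pair_pre_digraph. admissible \<rho> H \<and> 0 < codeg_density H")
    case True
    then show ?thesis using that best_above_positive unfolding r by blast
  next
    case False
    have "0 \<le> codeg_density G\<^sub>0"
      using G0 by (subst codeg_density_ge_iff) (auto simp: admissible_def)
    with False G0 that show ?thesis by (metis linorder_not_less order_trans)
  qed
  have "max_codeg_density \<rho> = codeg_density G"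
    unfolding max_codeg_density_def by (rule cSup_eq_maximum) (use G max in auto)
  with G show ?thesis by metis
qed

end
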